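(* The class of discrete countable groups $G$ which admit a proper quasi-1-cocycle $c\colon G\to\ell^2G^{\oplus\infty}$ is closed under passing to subgroups and under forming free products. That is: if $G$ is in the class and $K\subset G$ is a subgroup, then $K$ is in the class; and if $G$ and $H$ are in the class, then $G\ast H$ is in the class.
   Context: $\ell^2 G$ is the Hilbert space with orthonormal basis $G$ with the left regular representation; $\ell^2G^{\oplus\infty}$ is the Hilbert space direct sum of countably infinitely many copies. For a unitary representation $\pi\colon G\to U(H_\pi)$, a quasi-1-cocycle is a map $c\colon G\to H_\pi$ such that $(g,h)\mapsto \pi(g)c(h)-c(gh)+c(g)$ is uniformly bounded on $G\times G$. It is proper if for every $R>0$ the set $\{g\in G: \|c(g)\|\le R\}$ is finite. *)

theory Defs
  imports "HOL-Analysis.Analysis" "HOL-Algebra.Group" "HOL-Library.Function_Algebras"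
begin

section \<open>The Hilbert space \<open>\<ell>\<^sup>2G\<^sup>\<oplus>\<^sup>\<infinity>\<close> and its left regular representation\<close>

text \<open>
  Groups are carrier-based, so a vector of \<open>\<ell>\<^sup>2 X\<close> is a square-summable function on the whole
  type that vanishes off the set \<open>X\<close>; this makes equality of functions coincide with equality
  of vectors.
\<close>

definition l2_norm :: "'a set \<Rightarrow> ('a \<Rightarrow> complex) \<Rightarrow> real" where
  "l2_norm X f = sqrt (\<Sum>\<^sub>\<infinity>x\<in>X. (cmod (f x))\<^sup>2)"

definition l2_space :: "'a set \<Rightarrow> ('a \<Rightarrow> complex) set" where
  "l2_space X = {f. (\<forall>x. x \<notin> X \<longrightarrow> f x = 0) \<and> (\<lambda>x. (cmod (f x))\<^sup>2) summable_on X}"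

definition l2_sum_norm :: "'a set \<Rightarrow> (nat \<Rightarrow> 'a \<Rightarrow> complex) \<Rightarrow> real" where
  "l2_sum_norm X \<xi> = sqrt (\<Sum>\<^sub>\<infinity>n. (l2_norm X (\<xi> n))\<^sup>2)"

definition l2_sum_space :: "'a set \<Rightarrow> (nat \<Rightarrow> 'a \<Rightarrow> complex) set" where
  "l2_sum_space X =
     {\<xi>. (\<forall>n. \<xi> n \<in> l2_space X) \<and> (\<lambda>n. (l2_norm X (\<xi> n))\<^sup>2) summable_on UNIV}"

definition left_regular ::
  "('a, 'm) monoid_scheme \<Rightarrow> 'a \<Rightarrow> ('a \<Rightarrow> complex) \<Rightarrow> ('a \<Rightarrow> complex)" where
  "left_regular G g f = (\<lambda>x. if x \<in> carrier G then f (inv\<^bsub>G\<^esub> g \<otimes>\<^bsub>G\<^esub> x) else 0)"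

definition left_regular_sum ::
  "('a, 'm) monoid_scheme \<Rightarrow> 'a \<Rightarrow> (nat \<Rightarrow> 'a \<Rightarrow> complex) \<Rightarrow> (nat \<Rightarrow> 'a \<Rightarrow> complex)" where
  "left_regular_sum G g \<xi> = (\<lambda>n. left_regular G g (\<xi> n))"

text \<open>
  The following facts, together with the evident linearity, say that the representation is unitary.
\<close>

lemma bij_betw_left_translation:
  assumes "group G" "g \<in> carrier G"
  shows "bij_betw (\<lambda>x. inv\<^bsub>G\<^esub> g \<otimes>\<^bsub>G\<^esub> x) (carrier G) (carrier G)"
proof -
  interpret group G by fact
  show ?thesis
    by (rule bij_betwI[where g = "\<lambda>x. g \<otimes>\<^bsub>G\<^esub> x"])
       (use assms(2) in \<open>auto simp: m_assoc[symmetric]\<close>)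
qed

lemma l2_norm_left_regular:
  assumes "group G" "g \<in> carrier G"
  shows "l2_norm (carrier G) (left_regular G g f) = l2_norm (carrier G) f"
proof -
  have "(\<Sum>\<^sub>\<infinity>x\<in>carrier G. (cmod (left_regular G g f x))\<^sup>2)
      = (\<Sum>\<^sub>\<infinity>x\<in>carrier G. (cmod (f (inv\<^bsub>G\<^esub> g \<otimes>\<^bsub>G\<^esub> x)))\<^sup>2)"
    by (rule infsum_cong) (simp add: left_regular_def)
  also have "\<dots> = (\<Sum>\<^sub>\<infinity>x\<in>carrier G. (cmod (f x))\<^sup>2)"
    by (rule infsum_reindex_bij_betw[OF bij_betw_left_translation[OF assms]])
  finally show ?thesis by (simp add: l2_norm_def)
qed

lemma left_regular_l2_space:
  assumes "group G" "g \<in> carrier G" "f \<in> l2_space (carrier G)"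
  shows "left_regular G g f \<in> l2_space (carrier G)"
proof -
  have "(\<lambda>x. (cmod (f (inv\<^bsub>G\<^esub> g \<otimes>\<^bsub>G\<^esub> x)))\<^sup>2) summable_on carrier G"
    using assms(3) summable_on_reindex_bij_betw[OF bij_betw_left_translation[OF assms(1,2)],
        of "\<lambda>x. (cmod (f x))\<^sup>2"]
    by (simp add: l2_space_def)
  hence "(\<lambda>x. (cmod (left_regular G g f x))\<^sup>2) summable_on carrier G"
    by (rule summable_on_cong[THEN iffD1, rotated]) (simp add: left_regular_def)
  thus ?thesis by (simp add: l2_space_def left_regular_def)
qed

lemma l2_sum_norm_left_regular_sum:
  assumes "group G" "g \<in> carrier G"
  shows "l2_sum_norm (carrier G) (left_regular_sum G g \<xi>) = l2_sum_norm (carrier G) \<xi>"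
  by (simp add: l2_sum_norm_def left_regular_sum_def l2_norm_left_regular[OF assms])

lemma left_regular_sum_l2_sum_space:
  assumes "group G" "g \<in> carrier G" "\<xi> \<in> l2_sum_space (carrier G)"
  shows "left_regular_sum G g \<xi> \<in> l2_sum_space (carrier G)"
  using assms(3)
  by (simp add: l2_sum_space_def left_regular_sum_def l2_norm_left_regular[OF assms(1,2)]
      left_regular_l2_space[OF assms(1,2)])

lemma left_regular_sum_one:
  assumes "group G" "\<xi> \<in> l2_sum_space (carrier G)"
  shows "left_regular_sum G \<one>\<^bsub>G\<^esub> \<xi> = \<xi>"
proof -
  interpret group G by fact
  show ?thesis
    using assms(2)
    by (auto simp: l2_sum_space_def l2_space_def left_regular_sum_def left_regular_def fun_eq_iff)
qed

lemma left_regular_sum_mult: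
  assumes "group G" "g \<in> carrier G" "h \<in> carrier G"
  shows "left_regular_sum G (g \<otimes>\<^bsub>G\<^esub> h) \<xi> = left_regular_sum G g (left_regular_sum G h \<xi>)"
proof -
  interpret group G by fact
  show ?thesis
    using assms(2,3)
    by (auto simp: left_regular_sum_def left_regular_def fun_eq_iff inv_mult_group m_assoc)
qed

section \<open>Quasi-1-cocycles\<close>

text \<open>
  A representation of \<open>G\<close> is given by the underlying set \<open>V\<close> of the Hilbert space, its norm \<open>N\<close>
  and the action \<open>\<pi>\<close>.  Only the values of \<open>c\<close> on \<open>carrier G\<close> are relevant.
\<close>

definition quasi_1_cocycle ::
  "('g, 'm) monoid_scheme \<Rightarrow> 'v set \<Rightarrow> ('v \<Rightarrow> real) \<Rightarrow> ('g \<Rightarrow> 'v \<Rightarrow> 'v)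
    \<Rightarrow> ('g \<Rightarrow> 'v::ab_group_add) \<Rightarrow> bool" where
  "quasi_1_cocycle G V N \<pi> c \<longleftrightarrow>
     c \<in> carrier G \<rightarrow> V \<and>
     (\<exists>C. \<forall>g\<in>carrier G. \<forall>h\<in>carrier G. N (\<pi> g (c h) - c (g \<otimes>\<^bsub>G\<^esub> h) + c g) \<le> C)"

definition proper_cochain ::
  "('g, 'm) monoid_scheme \<Rightarrow> ('v \<Rightarrow> real) \<Rightarrow> ('g \<Rightarrow> 'v) \<Rightarrow> bool" where
  "proper_cochain G N c \<longleftrightarrow> (\<forall>R>0. finite {g \<in> carrier G. N (c g) \<le> R})"

definition admits_proper_quasi_1_cocycle :: "('g, 'm) monoid_scheme \<Rightarrow> bool" where
  "admits_proper_quasi_1_cocycle G \<longleftrightarrow>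
     group G \<and> countable (carrier G) \<and>
     (\<exists>c. quasi_1_cocycle G (l2_sum_space (carrier G)) (l2_sum_norm (carrier G))
            (left_regular_sum G) c \<and>
          proper_cochain G (l2_sum_norm (carrier G)) c)"

section \<open>Free products\<close>

text \<open>
  The free product of two groups is the group of reduced words, that is, alternating words in
  the non-trivial elements of the two factors; a product is computed by prepending the letters
  of the left word one after the other to the right word, merging (and possibly cancelling)
  adjacent letters from the same factor.
\<close>

definition fp_letters ::
  "('a, 'm) monoid_scheme \<Rightarrow> ('b, 'n) monoid_scheme \<Rightarrow> ('a + 'b) set" where
  "fp_letters G H = (carrier G - {\<one>\<^bsub>G\<^esub>}) <+> (carrier H - {\<one>\<^bsub>H\<^esub>})"

definition fp_words ::
  "('a, 'm) monoid_scheme \<Rightarrow> ('b, 'n) monoid_scheme \<Rightarrow> ('a + 'b) list set" where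
  "fp_words G H =
     {w. set w \<subseteq> fp_letters G H \<and> successively (\<lambda>x y. isl x \<noteq> isl y) w}"

fun fp_cons ::
  "('a, 'm) monoid_scheme \<Rightarrow> ('b, 'n) monoid_scheme \<Rightarrow> 'a + 'b \<Rightarrow> ('a + 'b) list
    \<Rightarrow> ('a + 'b) list" where
  "fp_cons G H (Inl a) (Inl b # w) =
     (if a \<otimes>\<^bsub>G\<^esub> b = \<one>\<^bsub>G\<^esub> then w else Inl (a \<otimes>\<^bsub>G\<^esub> b) # w)"
| "fp_cons G H (Inr a) (Inr b # w) =
     (if a \<otimes>\<^bsub>H\<^esub> b = \<one>\<^bsub>H\<^esub> then w else Inr (a \<otimes>\<^bsub>H\<^esub> b) # w)"
| "fp_cons G H x w = x # w"

definition free_product ::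
  "('a, 'm) monoid_scheme \<Rightarrow> ('b, 'n) monoid_scheme \<Rightarrow> ('a + 'b) list monoid" where
  "free_product G H =
     \<lparr>carrier = fp_words G H, mult = (\<lambda>v w. foldr (fp_cons G H) v w), one = []\<rparr>"

lemma Nil_in_fp_words [simp]: "[] \<in> fp_words G H"
  by (simp add: fp_words_def)

lemma fp_words_ConsD:
  assumes "x # w \<in> fp_words G H"
  shows "x \<in> fp_letters G H" "w \<in> fp_words G H"
  using assms by (auto simp: fp_words_def successively_Cons)

lemma fp_cons_in_fp_words:
  assumes "group G" "group H" "x \<in> fp_letters G H" "w \<in> fp_words G H"
  shows "fp_cons G H x w \<in> fp_words G H"
proof -
  interpret G: group G by fact
  interpret H: group H by fact
  show ?thesis
    using assms(3,4)
    by (cases "(G, H, x, w)" rule: fp_cons.cases)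
       (auto simp: fp_words_def fp_letters_def successively_Cons)
qed

lemma foldr_fp_cons_in_fp_words:
  assumes "group G" "group H" "v \<in> fp_words G H" "w \<in> fp_words G H"
  shows "foldr (fp_cons G H) v w \<in> fp_words G H"
  using assms(3)
  by (induction v) (auto dest: fp_words_ConsD intro: fp_cons_in_fp_words assms)

lemma fp_cons_Inl_Inl:
  assumes "group G" "Inl a \<in> fp_letters G H" "Inl b \<in> fp_letters G H" "w \<in> fp_words G H"
  shows "fp_cons G H (Inl a) (fp_cons G H (Inl b) w)
    = (if a \<otimes>\<^bsub>G\<^esub> b = \<one>\<^bsub>G\<^esub> then w else fp_cons G H (Inl (a \<otimes>\<^bsub>G\<^esub> b)) w)"
proof -
  interpret G: group G by fact
  have ab: "a \<in> carrier G" "b \<in> carrier G" "a \<noteq> \<one>\<^bsub>G\<^esub>" "b \<noteq> \<one>\<^bsub>G\<^esub>"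
    using assms(2,3) by (auto simp: fp_letters_def)
  show ?thesis
  proof (cases "\<exists>d u. w = Inl d # u")
    case False
    then show ?thesis
      by (cases w; cases "hd w") auto
  next
    case True
    then obtain d u where w: "w = Inl d # u" by blast
    have d: "d \<in> carrier G" "d \<noteq> \<one>\<^bsub>G\<^esub>"
      using assms(4) w by (auto simp: fp_words_def fp_letters_def)
    have u: "fp_cons G H (Inl z) u = Inl z # u" for z
      using assms(4) w by (cases u; cases "hd u") (auto simp: fp_words_def successively_Cons)
    have assoc: "a \<otimes>\<^bsub>G\<^esub> b \<otimes>\<^bsub>G\<^esub> d = a \<otimes>\<^bsub>G\<^esub> (b \<otimes>\<^bsub>G\<^esub> d)"
      using ab d by (simp add: G.m_assoc)
    show ?thesis
    proof (cases "b \<otimes>\<^bsub>G\<^esub> d = \<one>\<^bsub>G\<^esub>")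
      case True
      then show ?thesis using assoc ab d w u by auto
    next
      case False
      then show ?thesis using assoc ab d w u by auto
    qed
  qed
qed

lemma fp_cons_Inr_Inr:
  assumes "group H" "Inr a \<in> fp_letters G H" "Inr b \<in> fp_letters G H" "w \<in> fp_words G H"
  shows "fp_cons G H (Inr a) (fp_cons G H (Inr b) w)
    = (if a \<otimes>\<^bsub>H\<^esub> b = \<one>\<^bsub>H\<^esub> then w else fp_cons G H (Inr (a \<otimes>\<^bsub>H\<^esub> b)) w)"
proof -
  interpret H: group H by fact
  have ab: "a \<in> carrier H" "b \<in> carrier H" "a \<noteq> \<one>\<^bsub>H\<^esub>" "b \<noteq> \<one>\<^bsub>H\<^esub>"
    using assms(2,3) by (auto simp: fp_letters_def)
  show ?thesis
  proof (cases "\<exists>d u. w = Inr d # u")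
    case False
    then show ?thesis
      by (cases w; cases "hd w") auto
  next
    case True
    then obtain d u where w: "w = Inr d # u" by blast
    have d: "d \<in> carrier H" "d \<noteq> \<one>\<^bsub>H\<^esub>"
      using assms(4) w by (auto simp: fp_words_def fp_letters_def)
    have u: "fp_cons G H (Inr z) u = Inr z # u" for z
      using assms(4) w by (cases u; cases "hd u") (auto simp: fp_words_def successively_Cons)
    have assoc: "a \<otimes>\<^bsub>H\<^esub> b \<otimes>\<^bsub>H\<^esub> d = a \<otimes>\<^bsub>H\<^esub> (b \<otimes>\<^bsub>H\<^esub> d)"
      using ab d by (simp add: H.m_assoc)
    show ?thesis
    proof (cases "b \<otimes>\<^bsub>H\<^esub> d = \<one>\<^bsub>H\<^esub>")
      case True
      then show ?thesis using assoc ab d w u by auto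
    next
      case False
      then show ?thesis using assoc ab d w u by auto
    qed
  qed
qed

lemma foldr_fp_cons_fp_cons:
  assumes "group G" "group H" "x \<in> fp_letters G H" "v \<in> fp_words G H" "w \<in> fp_words G H"
  shows "foldr (fp_cons G H) (fp_cons G H x v) w = fp_cons G H x (foldr (fp_cons G H) v w)"
  using assms(3,4)
proof (cases "(G, H, x, v)" rule: fp_cons.cases)
  case (1 G' H' a b u)
  then have bu: "Inl b \<in> fp_letters G H" "u \<in> fp_words G H"
    using fp_words_ConsD[of "Inl b" u G H] assms(4) by auto
  note uw = foldr_fp_cons_in_fp_words[OF assms(1,2) bu(2) assms(5)]
  show ?thesis
    using 1 assms(3) bu(1) uw fp_cons_Inl_Inl[OF assms(1), of a H b "foldr (fp_cons G H) u w"] by auto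
next
  case (2 G' H' a b u)
  then have bu: "Inr b \<in> fp_letters G H" "u \<in> fp_words G H"
    using fp_words_ConsD[of "Inr b" u G H] assms(4) by auto
  note uw = foldr_fp_cons_in_fp_words[OF assms(1,2) bu(2) assms(5)]
  show ?thesis
    using 2 assms(3) bu(1) uw fp_cons_Inr_Inr[OF assms(2), of a G b "foldr (fp_cons G H) u w"] by auto
qed auto

lemma foldr_fp_cons_assoc:
  assumes "group G" "group H" "u \<in> fp_words G H" "v \<in> fp_words G H" "w \<in> fp_words G H"
  shows "foldr (fp_cons G H) (foldr (fp_cons G H) u v) w
    = foldr (fp_cons G H) u (foldr (fp_cons G H) v w)"
  using assms(3)
proof (induction u)
  case (Cons x u)
  note xu = fp_words_ConsD[OF Cons.prems]
  show ?case
    using foldr_fp_cons_fp_cons[OF assms(1,2) xu(1) foldr_fp_cons_in_fp_words[OF assms(1,2) xu(2) assms(4)]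
        assms(5)] Cons.IH[OF xu(2)]
    by simp
qed simp

theorem group_free_product:
  assumes "group G" "group H"
  shows "group (free_product G H)"
proof -
  interpret G: group G by fact
  interpret H: group H by fact
  let ?m = "foldr (fp_cons G H)"
  have unit: "?m w [] = w" if "w \<in> fp_words G H" for w
    using that
  proof (induction w)
    case (Cons x w)
    then have "?m w [] = w" by (auto dest: fp_words_ConsD)
    moreover have "fp_cons G H x w = x # w"
      using Cons.prems
      by (cases "(G, H, x, w)" rule: fp_cons.cases) (auto simp: fp_words_def)
    ultimately show ?case by simp
  qed simp
  have inverse: "\<exists>v\<in>fp_words G H. ?m v w = []" if "w \<in> fp_words G H" for w
    using that
  proof (induction w)
    case Nil
    then show ?case by (intro bexI[of _ "[]"]) auto
  next
    case (Cons x w)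
    note xw = fp_words_ConsD[OF Cons.prems]
    obtain v where v: "v \<in> fp_words G H" "?m v w = []"
      using Cons.IH xw(2) by blast
    define y where "y = (case x of Inl a \<Rightarrow> Inl (inv\<^bsub>G\<^esub> a) | Inr b \<Rightarrow> Inr (inv\<^bsub>H\<^esub> b))"
    have y: "[y] \<in> fp_words G H" "?m [y] (x # w) = w"
      using xw by (auto simp: y_def fp_words_def fp_letters_def)
    have "?m (?m v [y]) (x # w) = []"
      using foldr_fp_cons_assoc[OF assms v(1) y(1) Cons.prems] y(2) v(2) by simp
    then show ?case
      using foldr_fp_cons_in_fp_words[OF assms v(1) y(1)] by blast
  qed
  show ?thesis
    by (rule groupI)
       (auto simp: free_product_def foldr_fp_cons_in_fp_words[OF assms]
         foldr_fp_cons_assoc[OF assms] inverse)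
qed

end

theory Submission
  imports Defs
begin

text \<open>
  A vector of \<open>\<ell>\<^sup>2G\<^sup>\<oplus>\<^sup>\<infinity>\<close> is a square-summable function on the set \<open>\<nat> \<times> G\<close>, on which \<open>G\<close> acts
  freely by translation.  More generally, if \<open>X\<close> is any countable set with a free action of \<open>G\<close>,
  a choice of orbit representatives embeds \<open>X\<close> equivariantly into \<open>\<nat> \<times> G\<close>, hence \<open>\<ell>\<^sup>2X\<close>
  isometrically and equivariantly into \<open>\<ell>\<^sup>2G\<^sup>\<oplus>\<^sup>\<infinity>\<close>.  So it suffices to find a proper quasi-cocycle
  with values in \<open>\<ell>\<^sup>2X\<close> for some such \<open>X\<close> (\<open>admits_if_proper_quasi\<close>).  This settles the case of a
  subgroup \<open>K\<close>, which acts freely on \<open>\<nat> \<times> G\<close>: restrict the quasi-cocycle of \<open>G\<close>.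

  For a free product, the quasi-cocycles \<open>c\<close> of \<open>G\<close> and \<open>d\<close> of \<open>H\<close> are first normalised
  (\<open>proper_quasi_normalised\<close>): a bounded change, harmless to both properness and the quasi-cocycle
  property, makes them alternating, \<open>c(g) = - g c(g\<^sup>-\<^sup>1)\<close>, and at least \<open>1\<close> in norm away from the
  unit.  Regard the values of \<open>c\<close> and \<open>d\<close> as vectors over \<open>G * H\<close>, in different copies of the
  regular representation, and write \<open>\<iota>(x)\<close> for the resulting vector of a letter \<open>x\<close>.  On a reduced
  word \<open>x\<^sub>1\<dots>x\<^sub>n\<close> put
    \<open>b(x\<^sub>1\<dots>x\<^sub>n) = \<iota>(x\<^sub>1) + x\<^sub>1 \<iota>(x\<^sub>2) + \<dots> + x\<^sub>1\<dots>x\<^sub>n\<^sub>-\<^sub>1 \<iota>(x\<^sub>n)\<close>.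

  In a product of two reduced words, letters cancel until either nothing more interacts or two
  letters of one factor merge to a non-trivial letter.  Because \<open>c\<close> and \<open>d\<close> are alternating, a
  cancellation contributes nothing to the defect of \<open>b\<close>; a merging contributes a translate of a
  defect of \<open>c\<close> or \<open>d\<close>, and happens at most once.  Hence \<open>b\<close> is a quasi-cocycle
  (\<open>word_defect\<close>).

  The summands of \<open>b(x\<^sub>1\<dots>x\<^sub>n)\<close> are supported on distinct cosets of \<open>G\<close>, or of \<open>H\<close>, or lie in
  different copies of the regular representation.  By Pythagoras the squared norm of
  \<open>b(x\<^sub>1\<dots>x\<^sub>n)\<close> is the sum of those of the \<open>\<iota>(x\<^sub>i)\<close> (\<open>b_norm\<close>).  A bound on it therefore bounds the
  number of letters, each contributing at least \<open>1\<close>, and confines each letter to a finite set by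
  properness of \<open>c\<close> and \<open>d\<close>.  So \<open>b\<close> is proper.
\<close>

section \<open>The Hilbert space of square-summable functions on a set\<close>

lemma l2_norm_nonneg [simp]: "0 \<le> l2_norm X f"
  by (simp add: l2_norm_def infsum_nonneg)

lemma l2_norm_sq: "(l2_norm X f)\<^sup>2 = (\<Sum>\<^sub>\<infinity>x\<in>X. (cmod (f x))\<^sup>2)"
  by (simp add: l2_norm_def infsum_nonneg)

lemma l2_space_off: "f \<in> l2_space X \<Longrightarrow> x \<notin> X \<Longrightarrow> f x = 0"
  by (simp add: l2_space_def)

lemma L2_set_le_l2_norm:
  assumes "f \<in> l2_space X" "finite F" "F \<subseteq> X"
  shows "L2_set (\<lambda>x. cmod (f x)) F \<le> l2_norm X f"
  using assms unfolding L2_set_def l2_norm_def l2_space_def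
  by (auto intro!: finite_sum_le_infsum)

text \<open>
  Uniform bounds over finite subsets give membership and the norm bound at once; this reduces the
  triangle inequality to the finite-dimensional one.
\<close>

lemma l2_spaceI:
  assumes "\<And>x. x \<notin> X \<Longrightarrow> f x = 0"
    and "\<And>F. finite F \<Longrightarrow> F \<subseteq> X \<Longrightarrow> L2_set (\<lambda>x. cmod (f x)) F \<le> B"
  shows "f \<in> l2_space X" "l2_norm X f \<le> B"
proof -
  have B: "0 \<le> B" using assms(2)[of "{}"] by simp
  have sum: "(\<Sum>x\<in>F. (cmod (f x))\<^sup>2) \<le> B\<^sup>2" if "finite F" "F \<subseteq> X" for F
    using assms(2)[OF that] B unfolding L2_set_def by (metis real_sqrt_le_iff real_sqrt_unique)
  have *: "(\<lambda>x. (cmod (f x))\<^sup>2) summable_on X"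
    by (rule nonneg_bdd_above_summable_on) (use sum in \<open>auto simp: bdd_above_def\<close>)
  show "f \<in> l2_space X" using assms(1) * by (simp add: l2_space_def)
  have "(\<Sum>\<^sub>\<infinity>x\<in>X. (cmod (f x))\<^sup>2) \<le> B\<^sup>2"
    by (rule infsum_le_finite_sums[OF *]) (use sum in auto)
  then show "l2_norm X f \<le> B"
    using B unfolding l2_norm_def by (simp add: real_le_lsqrt infsum_nonneg)
qed

lemma cmod_le_l2_norm:
  assumes "f \<in> l2_space X" "x \<in> X"
  shows "cmod (f x) \<le> l2_norm X f"
  using L2_set_le_l2_norm[OF assms(1), of "{x}"] assms(2) by (simp add: L2_set_def)

lemma l2_space_zero [simp]: "0 \<in> l2_space X"
  by (simp add: l2_space_def)

lemma l2_norm_zero [simp]: "l2_norm X 0 = 0"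
  by (simp add: l2_norm_def)

lemma
  assumes "f \<in> l2_space X" "g \<in> l2_space X"
  shows l2_space_add: "f + g \<in> l2_space X"
    and l2_norm_triangle: "l2_norm X (f + g) \<le> l2_norm X f + l2_norm X g"
proof -
  have bound: "L2_set (\<lambda>x. cmod ((f + g) x)) F \<le> l2_norm X f + l2_norm X g"
    if F: "finite F" "F \<subseteq> X" for F
  proof -
    have "L2_set (\<lambda>x. cmod ((f + g) x)) F \<le> L2_set (\<lambda>x. cmod (f x) + cmod (g x)) F"
      by (rule L2_set_mono) (auto simp: norm_triangle_ineq)
    also have "\<dots> \<le> L2_set (\<lambda>x. cmod (f x)) F + L2_set (\<lambda>x. cmod (g x)) F"
      by (rule L2_set_triangle_ineq)
    also have "\<dots> \<le> l2_norm X f + l2_norm X g"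
      using L2_set_le_l2_norm[OF assms(1) F] L2_set_le_l2_norm[OF assms(2) F] by simp
    finally show ?thesis .
  qed
  have off: "(f + g) x = 0" if "x \<notin> X" for x
    using assms that by (simp add: l2_space_off)
  show "f + g \<in> l2_space X" "l2_norm X (f + g) \<le> l2_norm X f + l2_norm X g"
    using l2_spaceI[OF off bound] by blast+
qed

lemma l2_space_scale: "f \<in> l2_space X \<Longrightarrow> (\<lambda>x. a * f x) \<in> l2_space X"
  by (auto simp: l2_space_def norm_mult power_mult_distrib intro: summable_on_cmult_right)

lemma l2_norm_scale: "l2_norm X (\<lambda>x. a * f x) = cmod a * l2_norm X f"
  by (simp add: l2_norm_def norm_mult power_mult_distrib infsum_cmult_right' real_sqrt_mult)

lemma l2_space_uminus: "f \<in> l2_space X \<Longrightarrow> - f \<in> l2_space X"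
  by (simp add: l2_space_def)

lemma l2_norm_uminus [simp]: "l2_norm X (- f) = l2_norm X f"
  by (simp add: l2_norm_def)

lemma
  assumes "f \<in> l2_space X" "g \<in> l2_space X"
  shows l2_space_diff: "f - g \<in> l2_space X"
    and l2_norm_diff: "l2_norm X (f - g) \<le> l2_norm X f + l2_norm X g"
  using l2_space_add[OF assms(1) l2_space_uminus[OF assms(2)]]
    l2_norm_triangle[OF assms(1) l2_space_uminus[OF assms(2)]] by simp_all

lemmas l2_space_closed = l2_space_add l2_space_diff l2_space_uminus l2_space_scale

lemma l2_norm_pythagoras:
  assumes "f \<in> l2_space X" "g \<in> l2_space X" and disj: "\<And>x. f x = 0 \<or> g x = 0"
  shows "(l2_norm X (f + g))\<^sup>2 = (l2_norm X f)\<^sup>2 + (l2_norm X g)\<^sup>2"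
proof -
  have "(\<Sum>\<^sub>\<infinity>x\<in>X. (cmod ((f + g) x))\<^sup>2) = (\<Sum>\<^sub>\<infinity>x\<in>X. (cmod (f x))\<^sup>2 + (cmod (g x))\<^sup>2)"
  proof (rule infsum_cong)
    fix x show "(cmod ((f + g) x))\<^sup>2 = (cmod (f x))\<^sup>2 + (cmod (g x))\<^sup>2"
      using disj[of x] by auto
  qed
  also have "\<dots> = (\<Sum>\<^sub>\<infinity>x\<in>X. (cmod (f x))\<^sup>2) + (\<Sum>\<^sub>\<infinity>x\<in>X. (cmod (g x))\<^sup>2)"
    using assms(1,2) by (intro infsum_add) (auto simp: l2_space_def)
  finally show ?thesis by (simp add: l2_norm_sq)
qed

lemma l2_space_indicator:
  assumes "y \<in> X"
  shows "(\<lambda>x. if x = y then 1 else 0) \<in> l2_space X"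
proof -
  let ?f = "\<lambda>x. (cmod (if x = y then 1 else 0))\<^sup>2"
  have "?f summable_on {y}" by simp
  then have "?f summable_on X"
    by (rule summable_on_cong_neutral[THEN iffD1, rotated 3]) (use assms in auto)
  then show ?thesis using assms by (auto simp: l2_space_def)
qed

text \<open>
  Extension by zero along an injection \<open>j\<close>: the isometry \<open>\<ell>\<^sup>2Y \<rightarrow> \<ell>\<^sup>2X\<close> sending the basis vector of
  \<open>y\<close> to that of \<open>j y\<close>.
\<close>

definition push :: "('y \<Rightarrow> 'x) \<Rightarrow> 'y set \<Rightarrow> ('y \<Rightarrow> complex) \<Rightarrow> 'x \<Rightarrow> complex" where
  "push j Y f x = (if x \<in> j ` Y then f (inv_into Y j x) else 0)"

lemma push_image: "inj_on j Y \<Longrightarrow> y \<in> Y \<Longrightarrow> push j Y f (j y) = f y"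
  by (simp add: push_def)

lemma push_add: "push j Y (f + g) = push j Y f + push j Y g"
  and push_diff: "push j Y (f - g) = push j Y f - push j Y g"
  and push_zero: "push j Y 0 = 0"
  by (auto simp: push_def)

lemma
  assumes j: "inj_on j Y" "j ` Y \<subseteq> X" and "f \<in> l2_space Y"
  shows push_l2_space: "push j Y f \<in> l2_space X"
    and l2_norm_push: "l2_norm X (push j Y f) = l2_norm Y f"
proof -
  let ?q = "\<lambda>x. (cmod (push j Y f x))\<^sup>2"
  have eq: "(?q \<circ> j) y = (cmod (f y))\<^sup>2" if "y \<in> Y" for y
    using that by (simp add: push_image[OF j(1)])
  have "(?q \<circ> j) summable_on Y"
    using assms(3) by (subst summable_on_cong[OF eq]) (simp_all add: l2_space_def)
  then have "?q summable_on j ` Y" by (simp add: summable_on_reindex[OF j(1)])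
  then have "?q summable_on X"
    by (rule summable_on_cong_neutral[THEN iffD1, rotated 3]) (use j(2) in \<open>auto simp: push_def\<close>)
  then show "push j Y f \<in> l2_space X"
    using j(2) by (auto simp: l2_space_def push_def)
  have "infsum ?q X = infsum ?q (j ` Y)"
    by (rule infsum_cong_neutral) (use j(2) in \<open>auto simp: push_def\<close>)
  also have "\<dots> = (\<Sum>\<^sub>\<infinity>y\<in>Y. (cmod (f y))\<^sup>2)"
    by (simp add: infsum_reindex[OF j(1)] infsum_cong[OF eq])
  finally show "l2_norm X (push j Y f) = l2_norm Y f" by (simp add: l2_norm_def)
qed

text \<open>
  By Tonelli's theorem, currying identifies \<open>\<ell>\<^sup>2X\<^sup>\<oplus>\<^sup>\<infinity>\<close> with \<open>\<ell>\<^sup>2(\<nat> \<times> X)\<close>.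
\<close>

lemma l2_norm_uncurry:
  assumes "case_prod \<xi> \<in> l2_space (UNIV \<times> X)"
  shows "l2_norm (UNIV \<times> X) (case_prod \<xi>) = l2_sum_norm X \<xi>"
proof -
  have s: "(\<lambda>p. (cmod (case_prod \<xi> p))\<^sup>2) summable_on (UNIV \<times> X)"
    using assms by (simp add: l2_space_def)
  show ?thesis
    using infsum_Sigma_banach[OF s] by (simp add: l2_norm_def l2_sum_norm_def infsum_nonneg)
qed

lemma uncurry_l2_space_iff:
  "case_prod \<xi> \<in> l2_space (UNIV \<times> X) \<longleftrightarrow> \<xi> \<in> l2_sum_space X"
proof
  assume A: "case_prod \<xi> \<in> l2_space (UNIV \<times> X)"
  then have s: "(\<lambda>p. (cmod (case_prod \<xi> p))\<^sup>2) summable_on (UNIV \<times> X)"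
    by (simp add: l2_space_def)
  then have s': "(\<lambda>(n, x). (cmod (\<xi> n x))\<^sup>2) summable_on (UNIV \<times> X)"
    by (simp add: case_prod_unfold)
  have fib: "(\<lambda>x. (cmod (\<xi> n x))\<^sup>2) summable_on X" for n
    using summable_on_SigmaD1[OF s', of n] by simp
  have "(\<lambda>n. \<Sum>\<^sub>\<infinity>x\<in>X. (cmod (\<xi> n x))\<^sup>2) summable_on UNIV"
    using summable_on_SigmaD[OF s] fib by simp
  then show "\<xi> \<in> l2_sum_space X"
    using A fib by (auto simp: l2_sum_space_def l2_space_def l2_norm_sq)
next
  assume A: "\<xi> \<in> l2_sum_space X"
  have "(\<lambda>p. (cmod (case_prod \<xi> p))\<^sup>2) summable_on (UNIV \<times> X)"
    by (rule summable_on_SigmaI[where g = "\<lambda>n. (l2_norm X (\<xi> n))\<^sup>2"])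
       (use A in \<open>auto simp: l2_sum_space_def l2_space_def l2_norm_sq intro!: has_sum_infsum\<close>)
  then show "case_prod \<xi> \<in> l2_space (UNIV \<times> X)"
    using A by (auto simp: l2_sum_space_def l2_space_def)
qed

section \<open>Representations on free sets\<close>

definition perm_rep ::
  "('g, 'm) monoid_scheme \<Rightarrow> 'x set \<Rightarrow> ('g \<Rightarrow> 'x \<Rightarrow> 'x) \<Rightarrow> 'g \<Rightarrow> ('x \<Rightarrow> complex) \<Rightarrow> 'x \<Rightarrow> complex"
  where "perm_rep G X act g f x = (if x \<in> X then f (act (inv\<^bsub>G\<^esub> g) x) else 0)"

locale free_gset = group G for G (structure) +
  fixes X :: "'x set" and act :: "'a \<Rightarrow> 'x \<Rightarrow> 'x"
  assumes act_closed: "g \<in> carrier G \<Longrightarrow> x \<in> X \<Longrightarrow> act g x \<in> X"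
    and act_one: "x \<in> X \<Longrightarrow> act \<one> x = x"
    and act_mult: "g \<in> carrier G \<Longrightarrow> h \<in> carrier G \<Longrightarrow> x \<in> X \<Longrightarrow> act (g \<otimes> h) x = act g (act h x)"
    and act_free: "g \<in> carrier G \<Longrightarrow> x \<in> X \<Longrightarrow> act g x = x \<Longrightarrow> g = \<one>"
begin

abbreviation "\<rho> \<equiv> perm_rep G X act"

lemma act_inv: "g \<in> carrier G \<Longrightarrow> x \<in> X \<Longrightarrow> act (inv g) (act g x) = x"
  and act_inv': "g \<in> carrier G \<Longrightarrow> x \<in> X \<Longrightarrow> act g (act (inv g) x) = x"
  by (simp_all flip: act_mult add: act_one)

text \<open>
  The form in which freeness is used: an element of an orbit determines the group element that
  carries a given base point to it.
\<close>

lemma act_cancel: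
  assumes "g \<in> carrier G" "h \<in> carrier G" "x \<in> X" "act g x = act h x"
  shows "g = h"
proof -
  have "act (inv h \<otimes> g) x = x"
    using assms by (simp add: act_mult act_inv)
  then have "inv h \<otimes> g = \<one>" using assms by (intro act_free) auto
  then show ?thesis using assms by (metis inv_equality inv_inv inv_closed)
qed

lemma bij_betw_act: "g \<in> carrier G \<Longrightarrow> bij_betw (act g) X X"
  by (rule bij_betwI[where g = "act (inv g)"]) (auto simp: act_closed act_inv act_inv')

lemma
  assumes "g \<in> carrier G" "f \<in> l2_space X"
  shows rho_l2_space: "\<rho> g f \<in> l2_space X"
    and l2_norm_rho: "l2_norm X (\<rho> g f) = l2_norm X f"
proof -
  have b: "bij_betw (act (inv g)) X X" using assms by (intro bij_betw_act) simp
  have eq: "(cmod (\<rho> g f x))\<^sup>2 = (cmod (f (act (inv g) x)))\<^sup>2" if "x \<in> X" for x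
    using that by (simp add: perm_rep_def)
  show "\<rho> g f \<in> l2_space X"
    using summable_on_reindex_bij_betw[OF b, of "\<lambda>x. (cmod (f x))\<^sup>2"] assms(2)
      summable_on_cong[where A = X, OF eq] by (simp add: l2_space_def) (simp add: perm_rep_def)
  show "l2_norm X (\<rho> g f) = l2_norm X f"
    using infsum_reindex_bij_betw[OF b, of "\<lambda>x. (cmod (f x))\<^sup>2"] infsum_cong[where A = X, OF eq]
    by (simp add: l2_norm_def)
qed

lemma rho_zero: "\<rho> g 0 = 0"
  and rho_add: "\<rho> g (e + f) = \<rho> g e + \<rho> g f"
  and rho_diff: "\<rho> g (e - f) = \<rho> g e - \<rho> g f"
  and rho_scale: "\<rho> g (\<lambda>x. a * f x) = (\<lambda>x. a * \<rho> g f x)"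
  by (auto simp: perm_rep_def fun_eq_iff)

lemma rho_mult:
  assumes "g \<in> carrier G" "h \<in> carrier G"
  shows "\<rho> g (\<rho> h f) = \<rho> (g \<otimes> h) f"
  using assms by (auto simp: perm_rep_def fun_eq_iff act_closed inv_mult_group act_mult)

lemma rho_one: "f \<in> l2_space X \<Longrightarrow> \<rho> \<one> f = f"
  by (auto simp: perm_rep_def fun_eq_iff act_one l2_space_off)

end

text \<open>
  An injection of sets that is equivariant along a map \<open>e\<close> of the acting groups induces an
  intertwining isometry.  With \<open>e\<close> the identity this compares free sets over one group; with \<open>e\<close>
  the inclusion of a factor it carries vectors from the factor to the free product.  A point
  outside the image of \<open>j\<close> is not moved into it, because \<open>e g\<close> preserves the image.
\<close>

lemma push_perm_rep:
  assumes X: "free_gset G X actX" and Y: "free_gset K Y actY"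
    and e: "e \<in> carrier K \<rightarrow> carrier G" "e (inv\<^bsub>K\<^esub> g) = inv\<^bsub>G\<^esub> (e g)"
    and j: "inj_on j Y" "j ` Y \<subseteq> X"
      "\<And>k y. k \<in> carrier K \<Longrightarrow> y \<in> Y \<Longrightarrow> j (actY k y) = actX (e k) (j y)"
    and g: "g \<in> carrier K"
  shows "push j Y (perm_rep K Y actY g f) = perm_rep G X actX (e g) (push j Y f)"
proof
  fix x
  interpret X: free_gset G X actX by fact
  interpret Y: free_gset K Y actY by fact
  have eg: "e g \<in> carrier G" using e(1) g by auto
  show "push j Y (perm_rep K Y actY g f) x = perm_rep G X actX (e g) (push j Y f) x"
  proof (cases "x \<in> j ` Y")
    case True
    then obtain y where y: "y \<in> Y" "x = j y" by blast
    have "actX (inv\<^bsub>G\<^esub> (e g)) x = j (actY (inv\<^bsub>K\<^esub> g) y)"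
      using y j(3)[of "inv\<^bsub>K\<^esub> g" y] e(2) g by simp
    moreover have "actY (inv\<^bsub>K\<^esub> g) y \<in> Y" using y g by (simp add: Y.act_closed)
    ultimately show ?thesis
      using y j(2) by (auto simp: perm_rep_def push_image[OF j(1)])
  next
    case False
    have "actX (inv\<^bsub>G\<^esub> (e g)) x \<notin> j ` Y" if "x \<in> X"
    proof
      assume "actX (inv\<^bsub>G\<^esub> (e g)) x \<in> j ` Y"
      then obtain y where y: "y \<in> Y" "actX (inv\<^bsub>G\<^esub> (e g)) x = j y" by blast
      then have "x = j (actY g y)" using X.act_inv'[OF eg that] j(3)[OF g y(1)] by simp
      then show False using False y g by (auto simp: Y.act_closed)
    qed
    then show ?thesis using False by (auto simp: perm_rep_def push_def)
  qed
qed

lemma free_gset_translation: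
  assumes "group G"
  shows "free_gset G (UNIV \<times> carrier G) (\<lambda>g (i, x). (i, g \<otimes>\<^bsub>G\<^esub> x))"
proof -
  interpret group G by fact
  show ?thesis by unfold_locales (auto simp: m_assoc)
qed

abbreviation translation :: "('g, 'm) monoid_scheme \<Rightarrow> 'g \<Rightarrow> 'i \<times> 'g \<Rightarrow> 'i \<times> 'g" where
  "translation G \<equiv> \<lambda>g (i, x). (i, g \<otimes>\<^bsub>G\<^esub> x)"

lemma uncurry_left_regular_sum:
  assumes "group G" "g \<in> carrier G"
  shows "case_prod (left_regular_sum G g \<xi>)
    = perm_rep G (UNIV \<times> carrier G) (translation G) g (case_prod \<xi>)"
  by (auto simp: left_regular_sum_def left_regular_def perm_rep_def)

lemma uncurry_diff_add: "case_prod (f - g + h) = case_prod f - case_prod g + case_prod h"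
  for f g h :: "'a \<Rightarrow> 'b \<Rightarrow> complex"
  by auto

lemma uncurry_defect:
  assumes "group G" and c: "\<And>g. g \<in> carrier G \<Longrightarrow> c g \<in> l2_sum_space (carrier G)"
    and gh: "g \<in> carrier G" "h \<in> carrier G"
  shows "l2_sum_norm (carrier G) (left_regular_sum G g (c h) - c (g \<otimes>\<^bsub>G\<^esub> h) + c g)
    = l2_norm (UNIV \<times> carrier G) (perm_rep G (UNIV \<times> carrier G) (translation G) g (case_prod (c h))
        - case_prod (c (g \<otimes>\<^bsub>G\<^esub> h)) + case_prod (c g))"
proof -
  interpret T: free_gset G "UNIV \<times> carrier G" "translation G"
    by (rule free_gset_translation) fact
  have "case_prod (left_regular_sum G g (c h) - c (g \<otimes>\<^bsub>G\<^esub> h) + c g) \<in> l2_space (UNIV \<times> carrier G)"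
    unfolding uncurry_diff_add uncurry_left_regular_sum[OF assms(1) gh(1)]
    using c gh by (intro l2_space_closed T.rho_l2_space) (simp_all add: uncurry_l2_space_iff)
  from l2_norm_uncurry[OF this] show ?thesis
    by (simp only: uncurry_diff_add uncurry_left_regular_sum[OF assms(1) gh(1)])
qed

text \<open>
  Choose a representative \<open>r x\<close> in each orbit.  By freeness \<open>x = t x \<cdot> r x\<close> for a unique group
  element \<open>t x\<close>, and \<open>x \<mapsto> (r x, t x)\<close> is the required embedding once the countably many
  representatives are numbered.
\<close>

lemma (in free_gset) countable_gset_embedding:
  assumes "countable X"
  obtains j :: "'x \<Rightarrow> nat \<times> 'a" where "inj_on j X" "j ` X \<subseteq> UNIV \<times> carrier G"
    "\<And>g x. g \<in> carrier G \<Longrightarrow> x \<in> X \<Longrightarrow> j (act g x) = translation G g (j x)"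
proof -
  define orb where "orb x = (\<lambda>g. act g x) ` carrier G" for x
  define r where "r x = (SOME y. y \<in> orb x)" for x
  define t where "t x = (SOME g. g \<in> carrier G \<and> act g (r x) = x)" for x
  have orb_act: "orb (act h x) = orb x" if h: "h \<in> carrier G" and x: "x \<in> X" for h x
  proof
    show "orb (act h x) \<subseteq> orb x"
      using h x by (auto simp: orb_def simp flip: act_mult)
    have "act g x = act (g \<otimes> inv h) (act h x)" if "g \<in> carrier G" for g
      using that h x by (simp add: act_mult act_closed act_inv)
    then show "orb x \<subseteq> orb (act h x)"
      using h unfolding orb_def by blast
  qed
  have r: "\<exists>g\<in>carrier G. r x = act g x" if "x \<in> X" for x
  proof -
    have "act \<one> x \<in> orb x" by (auto simp: orb_def)
    then have "r x \<in> orb x" unfolding r_def by (rule someI)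
    then show ?thesis by (auto simp: orb_def)
  qed
  have rX: "r x \<in> X" if "x \<in> X" for x
    using r[OF that] that act_closed by auto
  have t: "t x \<in> carrier G \<and> act (t x) (r x) = x" if x: "x \<in> X" for x
  proof -
    obtain g where "g \<in> carrier G" "r x = act g x" using r[OF x] by blast
    then have "inv g \<in> carrier G \<and> act (inv g) (r x) = x" using x by (simp add: act_inv)
    then show ?thesis unfolding t_def by (rule someI)
  qed
  have r_act: "r (act h x) = r x" if "h \<in> carrier G" "x \<in> X" for h x
    using orb_act[OF that] by (simp add: r_def)
  have t_act: "t (act h x) = h \<otimes> t x" if h: "h \<in> carrier G" and x: "x \<in> X" for h x
  proof (rule act_cancel)
    show "act (t (act h x)) (r x) = act (h \<otimes> t x) (r x)"
      using h x t[of x] t[of "act h x"] by (simp add: r_act act_closed act_mult rX)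
  qed (use h x t t[of "act h x"] in \<open>auto simp: rX act_closed\<close>)
  let ?j = "\<lambda>x. (to_nat_on X (r x), t x)"
  show thesis
  proof
    show "inj_on ?j X"
      using assms t rX by (intro inj_onI) (metis Pair_inject inj_on_to_nat_on inj_onD)
    show "?j ` X \<subseteq> UNIV \<times> carrier G" using t by auto
    show "?j (act g x) = translation G g (?j x)" if "g \<in> carrier G" "x \<in> X" for g x
      using that by (simp add: r_act t_act)
  qed
qed

section \<open>Proper quasi-cocycles with values in free permutation modules\<close>

context free_gset
begin

abbreviation proper_quasi :: "('a \<Rightarrow> 'x \<Rightarrow> complex) \<Rightarrow> bool" where
  "proper_quasi c \<equiv> quasi_1_cocycle G (l2_space X) (l2_norm X) \<rho> c \<and> proper_cochain G (l2_norm X) c"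

lemma admits_if_proper_quasi:
  assumes "countable (carrier G)" "countable X" and c: "proper_quasi c"
  shows "admits_proper_quasi_1_cocycle G"
proof -
  obtain j :: "'x \<Rightarrow> nat \<times> 'a" where j: "inj_on j X" "j ` X \<subseteq> UNIV \<times> carrier G"
    "\<And>g x. g \<in> carrier G \<Longrightarrow> x \<in> X \<Longrightarrow> j (act g x) = translation G g (j x)"
    using countable_gset_embedding[OF assms(2)] by blast
  interpret T: free_gset G "UNIV \<times> carrier G" "translation G :: 'a \<Rightarrow> nat \<times> 'a \<Rightarrow> nat \<times> 'a"
    by (rule free_gset_translation[OF group_axioms])
  have cX: "c g \<in> l2_space X" if "g \<in> carrier G" for g
    using c that by (auto simp: quasi_1_cocycle_def)
  obtain C where C: "\<And>g h. g \<in> carrier G \<Longrightarrow> h \<in> carrier G \<Longrightarrow>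
      l2_norm X (\<rho> g (c h) - c (g \<otimes> h) + c g) \<le> C"
    using c unfolding quasi_1_cocycle_def by blast
  define d where "d g = curry (push j X (c g))" for g
  have ud: "case_prod (d g) = push j X (c g)" for g by (simp add: d_def)
  have d: "d g \<in> l2_sum_space (carrier G)" "l2_sum_norm (carrier G) (d g) = l2_norm X (c g)"
    if "g \<in> carrier G" for g
  proof -
    have *: "case_prod (d g) \<in> l2_space (UNIV \<times> carrier G)"
      unfolding ud using push_l2_space[OF j(1,2) cX[OF that]] .
    then show "d g \<in> l2_sum_space (carrier G)" by (simp add: uncurry_l2_space_iff)
    show "l2_sum_norm (carrier G) (d g) = l2_norm X (c g)"
      using l2_norm_uncurry[OF *] l2_norm_push[OF j(1,2) cX[OF that]] by (simp add: ud)
  qed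
  have "l2_sum_norm (carrier G) (left_regular_sum G g (d h) - d (g \<otimes> h) + d g) \<le> C"
    if gh: "g \<in> carrier G" "h \<in> carrier G" for g h
  proof -
    have "T.\<rho> g (push j X (c h)) = push j X (\<rho> g (c h))"
      by (rule push_perm_rep[symmetric, where e = "\<lambda>g. g", OF T.free_gset_axioms free_gset_axioms])
         (use j gh in auto)
    then have "l2_sum_norm (carrier G) (left_regular_sum G g (d h) - d (g \<otimes> h) + d g)
      = l2_norm (UNIV \<times> carrier G) (push j X (\<rho> g (c h) - c (g \<otimes> h) + c g))"
      by (simp add: uncurry_defect[where c = d, OF group_axioms d(1) gh] ud push_add push_diff)
    also have "\<dots> = l2_norm X (\<rho> g (c h) - c (g \<otimes> h) + c g)"
      using cX gh by (intro l2_norm_push j l2_space_closed rho_l2_space) auto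
    finally show ?thesis using C[OF gh] by simp
  qed
  then have "quasi_1_cocycle G (l2_sum_space (carrier G)) (l2_sum_norm (carrier G))
      (left_regular_sum G) d"
    using d(1) unfolding quasi_1_cocycle_def by blast
  moreover have "proper_cochain G (l2_sum_norm (carrier G)) d"
    using c d(2) unfolding proper_cochain_def by (simp cong: conj_cong)
  ultimately show ?thesis
    using assms(1) group_axioms unfolding admits_proper_quasi_1_cocycle_def by blast
qed

text \<open>
  The defect depends linearly on the cochain, and that of a cochain bounded by \<open>B\<close> is at most
  \<open>3 B\<close>.
\<close>

lemma bounded_perturbation:
  assumes c: "proper_quasi c"
    and d: "\<And>g. g \<in> carrier G \<Longrightarrow> d g \<in> l2_space X"
    and B: "\<And>g. g \<in> carrier G \<Longrightarrow> l2_norm X (d g - c g) \<le> B"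
  shows "proper_quasi d"
proof -
  have cX: "c g \<in> l2_space X" if "g \<in> carrier G" for g
    using c that by (auto simp: quasi_1_cocycle_def)
  obtain C where C: "\<And>g h. g \<in> carrier G \<Longrightarrow> h \<in> carrier G \<Longrightarrow>
      l2_norm X (\<rho> g (c h) - c (g \<otimes> h) + c g) \<le> C"
    using c unfolding quasi_1_cocycle_def by blast
  define u where "u g = d g - c g" for g
  have u: "u g \<in> l2_space X" "l2_norm X (u g) \<le> B" if "g \<in> carrier G" for g
    using that B d cX by (auto simp: u_def intro: l2_space_closed)
  have du: "d g = c g + u g" for g by (simp add: u_def)
  have "l2_norm X (\<rho> g (d h) - d (g \<otimes> h) + d g) \<le> C + (B + B + B)"
    if gh: "g \<in> carrier G" "h \<in> carrier G" for g h
  proof -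
    have eq: "\<rho> g (d h) - d (g \<otimes> h) + d g
      = (\<rho> g (c h) - c (g \<otimes> h) + c g) + (\<rho> g (u h) - u (g \<otimes> h) + u g)" (is "_ = ?a + ?b")
      by (simp add: du rho_add)
    have "l2_norm X (?a + ?b) \<le> l2_norm X ?a + l2_norm X ?b"
      using gh u cX by (intro l2_norm_triangle l2_space_closed rho_l2_space) auto
    moreover have "l2_norm X ?b \<le> l2_norm X (\<rho> g (u h) - u (g \<otimes> h)) + l2_norm X (u g)"
      using gh u by (intro l2_norm_triangle l2_space_closed rho_l2_space) auto
    moreover have "l2_norm X (\<rho> g (u h) - u (g \<otimes> h)) \<le> l2_norm X (\<rho> g (u h)) + l2_norm X (u (g \<otimes> h))"
      using gh u by (intro l2_norm_diff l2_space_closed rho_l2_space) auto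
    moreover have "l2_norm X (\<rho> g (u h)) = l2_norm X (u h)" using gh u by (simp add: l2_norm_rho)
    moreover note C[OF gh] u(2)[OF gh(1)] u(2)[OF gh(2)] u(2)[OF m_closed[OF gh]]
    ultimately show ?thesis unfolding eq by linarith
  qed
  then have "quasi_1_cocycle G (l2_space X) (l2_norm X) \<rho> d"
    using d unfolding quasi_1_cocycle_def by blast
  moreover have "finite {g \<in> carrier G. l2_norm X (d g) \<le> R}" if "R > 0" for R
  proof (rule finite_subset)
    have "0 \<le> B" using B[OF one_closed] l2_norm_nonneg order_trans by blast
    then show "finite {g \<in> carrier G. l2_norm X (c g) \<le> R + B}"
      using c that unfolding proper_cochain_def by auto
    have "l2_norm X (c g) \<le> l2_norm X (d g) + B" if "g \<in> carrier G" for g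
      using l2_norm_diff[OF d[OF that] u(1)[OF that]] u(2)[OF that] by (simp add: du)
    then show "{g \<in> carrier G. l2_norm X (d g) \<le> R} \<subseteq> {g \<in> carrier G. l2_norm X (c g) \<le> R + B}"
      by force
  qed
  ultimately show ?thesis by (simp add: proper_cochain_def)
qed

text \<open>
  The projection \<open>(c(g) - g c(g\<^sup>-\<^sup>1)) / 2\<close> to alternating cochains differs from \<open>c(g)\<close> by half of
  \<open>c(g) + g c(g\<^sup>-\<^sup>1)\<close>, which is the defect of \<open>c\<close> at \<open>(g, g\<^sup>-\<^sup>1)\<close> up to the constant \<open>c(1)\<close>.
\<close>

lemma proper_quasi_alternating:
  assumes c: "proper_quasi c"
  obtains d where "proper_quasi d" "\<And>g. g \<in> carrier G \<Longrightarrow> d g + \<rho> g (d (inv g)) = 0"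
proof -
  have cX: "c g \<in> l2_space X" if "g \<in> carrier G" for g
    using c that by (auto simp: quasi_1_cocycle_def)
  obtain C where C: "\<And>g h. g \<in> carrier G \<Longrightarrow> h \<in> carrier G \<Longrightarrow>
      l2_norm X (\<rho> g (c h) - c (g \<otimes> h) + c g) \<le> C"
    using c unfolding quasi_1_cocycle_def by blast
  define d where "d g = (\<lambda>x. 1/2 * (c g - \<rho> g (c (inv g))) x)" for g
  have d: "d g \<in> l2_space X" if "g \<in> carrier G" for g
    unfolding d_def using that cX by (intro l2_space_closed rho_l2_space) auto
  have "l2_norm X (d g - c g) \<le> C + l2_norm X (c \<one>)" if g: "g \<in> carrier G" for g
  proof -
    let ?D = "\<rho> g (c (inv g)) - c (g \<otimes> inv g) + c g"
    have eq: "d g - c g = (\<lambda>x. - (1/2) * (?D + c \<one>) x)"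
      using g by (simp add: d_def fun_eq_iff algebra_simps)
    have "l2_norm X (d g - c g) = cmod (- (1/2)) * l2_norm X (?D + c \<one>)"
      by (simp only: eq l2_norm_scale)
    moreover have "cmod (- (1/2)) = 1/2" by simp
    moreover have "l2_norm X (?D + c \<one>) \<le> l2_norm X ?D + l2_norm X (c \<one>)"
      using g cX by (intro l2_norm_triangle l2_space_closed rho_l2_space) auto
    moreover have "l2_norm X ?D \<le> C" using C g by blast
    moreover have "0 \<le> l2_norm X (?D + c \<one>)" by (rule l2_norm_nonneg)
    ultimately show ?thesis by (simp only:)
  qed
  from bounded_perturbation[OF c d this] have "proper_quasi d" by simp
  moreover have "d g + \<rho> g (d (inv g)) = 0" if g: "g \<in> carrier G" for g
  proof -
    have "\<rho> g (\<rho> (inv g) (c g)) = c g"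
      using g cX by (simp add: rho_mult rho_one)
    then have "\<rho> g (d (inv g)) = (\<lambda>x. 1/2 * (\<rho> g (c (inv g)) - c g) x)"
      using g by (simp only: d_def rho_scale rho_diff inv_inv)
    then show ?thesis by (simp add: d_def fun_eq_iff algebra_simps)
  qed
  ultimately show thesis by (rule that)
qed

text \<open>
  Where an alternating quasi-cocycle is short, it is replaced by the coboundary \<open>g \<xi> - \<xi>\<close> of a basis
  vector \<open>\<xi>\<close>.  The coboundary is bounded and alternating, and by freeness it has norm at least \<open>1\<close>
  off the unit.  The set of replaced elements is closed under inversion, since \<open>c(g)\<close> and
  \<open>c(g\<^sup>-\<^sup>1)\<close> have the same norm, so the result is still alternating.
\<close>

lemma proper_quasi_normalised:
  assumes "X \<noteq> {}" and c: "proper_quasi c"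
  obtains d where "proper_quasi d" "\<And>g. g \<in> carrier G \<Longrightarrow> d g + \<rho> g (d (inv g)) = 0"
    "\<And>g. g \<in> carrier G \<Longrightarrow> g \<noteq> \<one> \<Longrightarrow> 1 \<le> l2_norm X (d g)"
proof -
  obtain y where y: "y \<in> X" using assms(1) by blast
  obtain b where b: "proper_quasi b" and alt: "\<And>g. g \<in> carrier G \<Longrightarrow> b g + \<rho> g (b (inv g)) = 0"
    using proper_quasi_alternating[OF c] by blast
  have bX: "b g \<in> l2_space X" if "g \<in> carrier G" for g
    using b that by (auto simp: quasi_1_cocycle_def)
  define \<xi> :: "'x \<Rightarrow> complex" where "\<xi> = (\<lambda>x. if x = y then 1 else 0)"
  have \<xi>: "\<xi> \<in> l2_space X" unfolding \<xi>_def using y by (rule l2_space_indicator)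
  define u where "u g = \<rho> g \<xi> - \<xi>" for g
  define d where "d g = (if l2_norm X (b g) < 1 then u g else b g)" for g
  have uX: "u g \<in> l2_space X" if "g \<in> carrier G" for g
    unfolding u_def using that \<xi> by (intro l2_space_closed rho_l2_space)
  have u_bound: "l2_norm X (u g) \<le> 2 * l2_norm X \<xi>" if "g \<in> carrier G" for g
    unfolding u_def using l2_norm_diff[OF rho_l2_space[OF that \<xi>] \<xi>] that \<xi>
    by (simp add: l2_norm_rho)
  have dX: "d g \<in> l2_space X" if "g \<in> carrier G" for g
    using that by (simp add: d_def uX bX)
  have "l2_norm X (d g - b g) \<le> 2 * l2_norm X \<xi> + 1" if "g \<in> carrier G" for g
    using l2_norm_diff[OF uX[OF that] bX[OF that]] u_bound[OF that] by (simp add: d_def)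
  from bounded_perturbation[OF b dX this] have "proper_quasi d" by simp
  moreover have "d g + \<rho> g (d (inv g)) = 0" if g: "g \<in> carrier G" for g
  proof -
    have "b g = - \<rho> g (b (inv g))" using alt[OF g] by (simp add: eq_neg_iff_add_eq_0)
    then have "l2_norm X (b (inv g)) = l2_norm X (b g)"
      using g bX by (simp add: l2_norm_rho)
    moreover have "u g + \<rho> g (u (inv g)) = 0"
      using g \<xi> by (simp add: u_def rho_diff rho_mult rho_one)
    ultimately show ?thesis using alt[OF g] by (simp add: d_def)
  qed
  moreover have "1 \<le> l2_norm X (d g)" if g: "g \<in> carrier G" "g \<noteq> \<one>" for g
  proof -
    \<comment> \<open>At the point \<open>y\<close> the coboundary takes the value \<open>0 - 1\<close>.\<close>
    have "act (inv g) y \<noteq> y" using act_free[of "inv g" y] g y by auto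
    then have "cmod (u g y) = 1" using y by (simp add: u_def perm_rep_def \<xi>_def)
    then have "1 \<le> l2_norm X (u g)" using cmod_le_l2_norm[OF uX[OF g(1)] y] by simp
    then show ?thesis by (simp add: d_def)
  qed
  ultimately show thesis by (rule that)
qed

end

text \<open>
  The converse of \<open>admits_if_proper_quasi\<close>, for the free set \<open>\<nat> \<times> G\<close>.
\<close>

lemma admits_proper_quasiD:
  assumes "admits_proper_quasi_1_cocycle G"
  obtains c where "free_gset.proper_quasi G (UNIV \<times> carrier G) (translation G) (c :: _ \<Rightarrow> nat \<times> _ \<Rightarrow> complex)"
proof -
  have G: "group G" using assms by (simp add: admits_proper_quasi_1_cocycle_def)
  obtain c where c: "quasi_1_cocycle G (l2_sum_space (carrier G)) (l2_sum_norm (carrier G))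
            (left_regular_sum G) c" and p: "proper_cochain G (l2_sum_norm (carrier G)) c"
    using assms by (auto simp: admits_proper_quasi_1_cocycle_def)
  have cX: "c g \<in> l2_sum_space (carrier G)" if "g \<in> carrier G" for g
    using c that by (auto simp: quasi_1_cocycle_def)
  have cn: "l2_norm (UNIV \<times> carrier G) (case_prod (c g)) = l2_sum_norm (carrier G) (c g)"
    if "g \<in> carrier G" for g
    using cX[OF that] by (simp add: l2_norm_uncurry uncurry_l2_space_iff)
  have "quasi_1_cocycle G (l2_space (UNIV \<times> carrier G)) (l2_norm (UNIV \<times> carrier G))
      (perm_rep G (UNIV \<times> carrier G) (translation G)) (\<lambda>g. case_prod (c g))"
    using c cX unfolding quasi_1_cocycle_def
    by (simp add: uncurry_defect[where c = c, OF G cX] uncurry_l2_space_iff Pi_iff)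
  moreover have "proper_cochain G (l2_norm (UNIV \<times> carrier G)) (\<lambda>g. case_prod (c g))"
    using p cn unfolding proper_cochain_def by (simp cong: conj_cong)
  ultimately show thesis by (intro that) auto
qed

theorem admits_subgroup:
  assumes "admits_proper_quasi_1_cocycle G" "subgroup K G"
  shows "admits_proper_quasi_1_cocycle (G\<lparr>carrier := K\<rparr>)"
proof -
  let ?X = "(UNIV :: nat set) \<times> carrier G" and ?K = "G\<lparr>carrier := K\<rparr>"
  obtain c where c: "free_gset.proper_quasi G ?X (translation G) c"
    using admits_proper_quasiD[OF assms(1)] by blast
  have G: "group G" and cnt: "countable (carrier G)"
    using assms(1) by (auto simp: admits_proper_quasi_1_cocycle_def)
  interpret G: group G by fact
  interpret K: subgroup K G by fact
  interpret X: free_gset ?K ?X "translation G"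
    using G.subgroup_imp_group[OF assms(2)]
    by (intro free_gset.intro free_gset_axioms.intro) (auto simp: G.m_assoc)
  have rep: "perm_rep ?K ?X (translation G) g f = perm_rep G ?X (translation G) g f" if "g \<in> K" for g f
    using that G.m_inv_consistent[OF assms(2)] by (auto simp: perm_rep_def fun_eq_iff)
  show ?thesis
  proof (rule X.admits_if_proper_quasi)
    show "countable (carrier ?K)" using cnt K.subset countable_subset by auto
    show "countable ?X" using cnt by simp
    have "finite {g \<in> K. l2_norm ?X (c g) \<le> R}" if "R > 0" for R
      by (rule finite_subset[of _ "{g \<in> carrier G. l2_norm ?X (c g) \<le> R}"])
         (use c that in \<open>auto simp: proper_cochain_def\<close>)
    moreover have "quasi_1_cocycle ?K (l2_space ?X) (l2_norm ?X) (perm_rep ?K ?X (translation G)) c"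
      using c unfolding quasi_1_cocycle_def by (simp add: rep Pi_iff) (meson K.mem_carrier)
    ultimately show "X.proper_quasi c" by (simp add: proper_cochain_def)
  qed
qed

section \<open>Letter-by-letter cochains on a free product\<close>

primrec word_cochain :: "(('a + 'b) list \<Rightarrow> 'v \<Rightarrow> 'v) \<Rightarrow> ('a + 'b \<Rightarrow> 'v::monoid_add)
    \<Rightarrow> ('a + 'b) list \<Rightarrow> 'v" where
  "word_cochain \<pi> \<iota> [] = 0"
| "word_cochain \<pi> \<iota> (x # w) = \<iota> x + \<pi> [x] (word_cochain \<pi> \<iota> w)"

lemma fp_words_Cons_iff:
  "x # w \<in> fp_words G H \<longleftrightarrow>
     x \<in> fp_letters G H \<and> w \<in> fp_words G H \<and> (w = [] \<or> isl x \<noteq> isl (hd w))"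
  by (auto simp: fp_words_def successively_Cons)

lemma fp_cons_eq_Cons:
  assumes "w = [] \<or> isl x \<noteq> isl (hd w)"
  shows "fp_cons G H x w = x # w"
  using assms by (cases "(G, H, x, w)" rule: fp_cons.cases) auto

lemma fp_cons_same_factor:
  assumes "group G" "group H" "x \<in> fp_letters G H" "y \<in> fp_letters G H" "isl x = isl y"
  obtains (cancel) "fp_cons G H x [y] = []" "\<And>u. fp_cons G H x (y # u) = u"
    | (merge) z where "z \<in> fp_letters G H" "isl z = isl x"
        "fp_cons G H x [y] = [z]" "\<And>u. fp_cons G H x (y # u) = z # u"
proof -
  interpret G: group G by fact
  interpret H: group H by fact
  show thesis
  proof (cases x)
    case (Inl a)
    then obtain b where "y = Inl b" using assms(5) by (cases y) auto
    then show thesis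
      using Inl assms(3,4) cancel merge[of "Inl (a \<otimes>\<^bsub>G\<^esub> b)"]
      by (cases "a \<otimes>\<^bsub>G\<^esub> b = \<one>\<^bsub>G\<^esub>") (auto simp: fp_letters_def)
  next
    case (Inr a)
    then obtain b where "y = Inr b" using assms(5) by (cases y) auto
    then show thesis
      using Inr assms(3,4) cancel merge[of "Inr (a \<otimes>\<^bsub>H\<^esub> b)"]
      by (cases "a \<otimes>\<^bsub>H\<^esub> b = \<one>\<^bsub>H\<^esub>") (auto simp: fp_letters_def)
  qed
qed

text \<open>
  The data from which a quasi-cocycle on the free product is assembled: a vector for each letter,
  alternating (\<open>letter_cancel\<close>) and with uniformly bounded defect (\<open>letter_merge\<close>) within each
  factor.  The boolean coordinate separates the two factors: with it, the translates of letter
  vectors occurring in one word have disjoint supports; over a single copy of the free product the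
  supports of neighbouring ones, cosets of \<open>G\<close> and of \<open>H\<close>, could share a point.
\<close>

locale letter_cochain =
  fixes G :: "('a, 'm) monoid_scheme" and H :: "('b, 'n) monoid_scheme"
    and \<iota> :: "'a + 'b \<Rightarrow> (bool \<times> nat) \<times> ('a + 'b) list \<Rightarrow> complex" and C :: real
  assumes G: "group G" and H: "group H" and C_nonneg: "0 \<le> C"
    and letter_l2: "x \<in> fp_letters G H \<Longrightarrow> \<iota> x \<in> l2_space (UNIV \<times> fp_words G H)"
    and letter_support: "x \<in> fp_letters G H \<Longrightarrow> \<iota> x ((s, n), p) \<noteq> 0 \<Longrightarrow>
      s = isl x \<and> (p = [] \<or> (\<exists>y. p = [y] \<and> isl y = isl x))"
    and letter_cancel: "x \<in> fp_letters G H \<Longrightarrow> y \<in> fp_letters G H \<Longrightarrow> isl x = isl y \<Longrightarrow>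
      fp_cons G H x [y] = [] \<Longrightarrow>
      \<iota> x + perm_rep (free_product G H) (UNIV \<times> fp_words G H) (translation (free_product G H)) [x] (\<iota> y) = 0"
    and letter_merge: "x \<in> fp_letters G H \<Longrightarrow> y \<in> fp_letters G H \<Longrightarrow> isl x = isl y \<Longrightarrow>
      fp_cons G H x [y] = [z] \<Longrightarrow>
      l2_norm (UNIV \<times> fp_words G H)
        (perm_rep (free_product G H) (UNIV \<times> fp_words G H) (translation (free_product G H)) [x] (\<iota> y)
          - \<iota> z + \<iota> x) \<le> C"
begin

abbreviation "P \<equiv> free_product G H"
abbreviation "L \<equiv> fp_letters G H"
abbreviation "W \<equiv> fp_words G H"
abbreviation "X \<equiv> (UNIV :: (bool \<times> nat) set) \<times> W"
abbreviation "\<pi> \<equiv> perm_rep P X (translation P)"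
abbreviation "b \<equiv> word_cochain \<pi> \<iota>"

lemma carrier_P [simp]: "carrier P = W"
  and mult_P: "v \<otimes>\<^bsub>P\<^esub> w = foldr (fp_cons G H) v w"
  and one_P [simp]: "\<one>\<^bsub>P\<^esub> = []"
  by (simp_all add: free_product_def)

sublocale T: free_gset P X "translation P"
  using free_gset_translation[OF group_free_product[OF G H]] by simp

lemma letter_word [simp]: "x \<in> L \<Longrightarrow> [x] \<in> W"
  by (simp add: fp_words_Cons_iff)

lemma fp_cons_eq_mult: "fp_cons G H x w = [x] \<otimes>\<^bsub>P\<^esub> w"
  by (simp add: mult_P)

lemma Cons_eq_mult: "x # w \<in> W \<Longrightarrow> x # w = [x] \<otimes>\<^bsub>P\<^esub> w"
  by (auto simp: mult_P fp_words_Cons_iff fp_cons_eq_Cons)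

lemma pi_Cons: "x # w \<in> W \<Longrightarrow> \<pi> (x # w) f = \<pi> [x] (\<pi> w f)"
  using Cons_eq_mult[of x w] T.rho_mult[of "[x]" w f] by (simp add: fp_words_Cons_iff)

lemma b_l2: "w \<in> W \<Longrightarrow> b w \<in> l2_space X"
proof (induction w)
  case (Cons x w)
  then have "x \<in> L" "w \<in> W" by (auto simp: fp_words_Cons_iff)
  then show ?case
    using Cons.IH unfolding word_cochain.simps
    by (intro l2_space_add T.rho_l2_space letter_l2) simp_all
qed simp

text \<open>
  If \<open>x\<close> does not meet a letter of its own factor, the defect is zero by the definition of \<open>b\<close>.
  Otherwise the contribution of the rest of the word drops out, leaving the defect of the letter
  cochain at \<open>x\<close> and the first letter of \<open>w\<close>, which is zero in case of cancellation.
\<close>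

lemma letter_defect:
  assumes x: "x \<in> L" and w: "w \<in> W"
  defines "D \<equiv> \<pi> [x] (b w) - b ([x] \<otimes>\<^bsub>P\<^esub> w) + \<iota> x"
  shows "D = 0 \<or> (l2_norm X D \<le> C \<and> [x] \<otimes>\<^bsub>P\<^esub> w \<noteq> [] \<and> isl (hd ([x] \<otimes>\<^bsub>P\<^esub> w)) = isl x)"
proof (cases "w = [] \<or> isl x \<noteq> isl (hd w)")
  case True
  then have "[x] \<otimes>\<^bsub>P\<^esub> w = x # w" by (simp add: fp_cons_eq_Cons flip: fp_cons_eq_mult)
  then show ?thesis by (simp add: D_def)
next
  case False
  then obtain y u where yu: "w = y # u" and same: "isl x = isl y" by (cases w) auto
  then have y: "y \<in> L" and u: "u \<in> W" using w by (auto simp: fp_words_Cons_iff)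
  have split: "\<pi> [x] (b w) = \<pi> [x] (\<iota> y) + \<pi> ([x] \<otimes>\<^bsub>P\<^esub> [y]) (b u)"
    using x y u by (simp add: yu T.rho_add T.rho_mult)
  show ?thesis
    using x y same
  proof (cases rule: fp_cons_same_factor[OF G H, consumes 3, case_names cancel merge])
    case cancel
    have "\<pi> [x] (b w) = \<pi> [x] (\<iota> y) + b u"
      unfolding split using cancel(1) T.rho_one[OF b_l2[OF u]] by (simp flip: fp_cons_eq_mult)
    moreover have "[x] \<otimes>\<^bsub>P\<^esub> w = u"
      using cancel by (simp add: yu flip: fp_cons_eq_mult)
    moreover have "\<iota> x + \<pi> [x] (\<iota> y) = 0" using letter_cancel[OF x y same cancel(1)] .
    ultimately have "D = 0" by (simp add: D_def algebra_simps)
    then show ?thesis ..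
  next
    case (merge z)
    have xw: "[x] \<otimes>\<^bsub>P\<^esub> w = z # u" using merge by (simp add: yu flip: fp_cons_eq_mult)
    have "D = \<pi> [x] (\<iota> y) - \<iota> z + \<iota> x"
      using merge(3) xw by (simp add: D_def split flip: fp_cons_eq_mult)
    then show ?thesis using letter_merge[OF x y same merge(3)] xw merge(2) by simp
  qed
qed

text \<open>
  Bounds for the single letters of \<open>v\<close> would add up, so the induction must show that only one of
  them contributes.  This is the reason for the additional information about the head: once a
  merging has occurred, the product begins with a letter of the same factor as the word \<open>v\<close>, so the
  next letter to be prepended belongs to the other factor and causes no further defect.
\<close>

lemma word_defect:
  assumes "v \<in> W" "w \<in> W"
  defines "D \<equiv> \<lambda>v. \<pi> v (b w) - b (v \<otimes>\<^bsub>P\<^esub> w) + b v"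
  shows "D v = 0 \<or> (l2_norm X (D v) \<le> C \<and> v \<noteq> [] \<and> v \<otimes>\<^bsub>P\<^esub> w \<noteq> [] \<and>
    isl (hd (v \<otimes>\<^bsub>P\<^esub> w)) = isl (hd v))"
  using assms(1)
proof (induction v)
  case Nil
  have "D [] = 0"
    using T.rho_one[OF b_l2[OF assms(2)]] by (simp add: D_def mult_P)
  then show ?case ..
next
  case (Cons x v)
  then have x: "x \<in> L" and v: "v \<in> W" by (auto simp: fp_words_Cons_iff)
  define q where "q = v \<otimes>\<^bsub>P\<^esub> w"
  have q: "q \<in> W" using T.m_closed[of v w] v assms(2) by (simp add: q_def)
  have xv: "(x # v) \<otimes>\<^bsub>P\<^esub> w = [x] \<otimes>\<^bsub>P\<^esub> q"
    by (simp add: q_def mult_P)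
  let ?E = "\<pi> [x] (b q) - b ([x] \<otimes>\<^bsub>P\<^esub> q) + \<iota> x"
  \<comment> \<open>The defect of \<open>xv\<close> is the translated defect of \<open>v\<close> plus that of the letter \<open>x\<close> at \<open>vw\<close>; at
    most one of the two is non-zero.\<close>
  have D: "D (x # v) = \<pi> [x] (D v) + ?E"
    using pi_Cons[OF Cons.prems, of "b w"]
    by (simp only: D_def xv T.rho_add T.rho_diff word_cochain.simps) (simp add: q_def)
  show "D (x # v) = 0 \<or> (l2_norm X (D (x # v)) \<le> C \<and> x # v \<noteq> [] \<and>
    (x # v) \<otimes>\<^bsub>P\<^esub> w \<noteq> [] \<and> isl (hd ((x # v) \<otimes>\<^bsub>P\<^esub> w)) = isl (hd (x # v)))"
  proof (cases "D v = 0")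
    case True
    then show ?thesis
      using letter_defect[OF x q] unfolding D xv by (auto simp: T.rho_zero)
  next
    case False
    then have IH: "l2_norm X (D v) \<le> C" "v \<noteq> []" "q \<noteq> []" "isl (hd q) = isl (hd v)"
      using Cons.IH[OF v] by (auto simp: q_def)
    then have "isl x \<noteq> isl (hd q)" using Cons.prems by (simp add: fp_words_Cons_iff)
    then have xq: "[x] \<otimes>\<^bsub>P\<^esub> q = x # q" by (simp add: fp_cons_eq_Cons flip: fp_cons_eq_mult)
    have "D v \<in> l2_space X"
      unfolding D_def using v assms(2) q
      by (intro l2_space_closed T.rho_l2_space b_l2) (simp_all add: q_def)
    then have "l2_norm X (\<pi> [x] (D v)) \<le> C" using IH(1) x by (simp add: T.l2_norm_rho)
    then show ?thesis unfolding D xv xq by simp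
  qed
qed

lemma translation_support:
  assumes "x \<in> L" "\<pi> [x] f ((s, n), q) \<noteq> 0"
  obtains p where "p \<in> W" "q = [x] \<otimes>\<^bsub>P\<^esub> p" "f ((s, n), p) \<noteq> 0"
proof (rule that)
  let ?p = "inv\<^bsub>P\<^esub> [x] \<otimes>\<^bsub>P\<^esub> q"
  have x: "[x] \<in> carrier P" using assms(1) by simp
  have q: "q \<in> carrier P" using assms(2) by (auto simp: perm_rep_def split: if_splits)
  show "?p \<in> W" using T.m_closed[OF T.inv_closed[OF x] q] by simp
  show "q = [x] \<otimes>\<^bsub>P\<^esub> ?p" using x q by (metis T.inv_solve_left T.inv_closed T.m_closed)
  show "f ((s, n), ?p) \<noteq> 0" using assms(2) by (auto simp: perm_rep_def split: if_splits)
qed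

text \<open>
  The point \<open>1\<close> of the free product lies in the support only in the copy belonging to the factor of
  the first letter.  This is what keeps \<open>\<iota> x\<close> and \<open>x b(w)\<close> apart below: their supports could meet
  only in the single point \<open>x\<close>, and there they live in different copies.
\<close>

lemma b_support:
  assumes "w \<in> W" "b w ((s, n), p) \<noteq> 0"
  shows "w \<noteq> [] \<and> (if p = [] then s = isl (hd w) else isl (hd p) = isl (hd w))"
  using assms
proof (induction w arbitrary: p)
  case (Cons x w)
  then have x: "x \<in> L" and w: "w \<in> W" by (auto simp: fp_words_Cons_iff)
  from Cons.prems(2) have "\<iota> x ((s, n), p) \<noteq> 0 \<or> \<pi> [x] (b w) ((s, n), p) \<noteq> 0" by auto
  then show ?case
  proof
    assume "\<iota> x ((s, n), p) \<noteq> 0"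
    then show ?thesis using letter_support[OF x] by force
  next
    assume "\<pi> [x] (b w) ((s, n), p) \<noteq> 0"
    from translation_support[OF x this] obtain r
      where r: "p = [x] \<otimes>\<^bsub>P\<^esub> r" "b w ((s, n), r) \<noteq> 0" by blast
    have "w \<noteq> []" "r = [] \<or> isl (hd r) = isl (hd w)"
      using Cons.IH[OF w r(2)] by (auto split: if_splits)
    then have "p = x # r"
      using Cons.prems(1) r(1) fp_cons_eq_Cons[of r x G H]
      by (auto simp: fp_words_Cons_iff simp flip: fp_cons_eq_mult)
    then show ?thesis by simp
  qed
qed simp

lemma letter_support_disjoint:
  assumes "x # w \<in> W"
  shows "\<iota> x i = 0 \<or> \<pi> [x] (b w) i = 0"
proof (rule ccontr)
  assume A: "\<not> ?thesis"
  have x: "x \<in> L" and w: "w \<in> W" using assms by (auto simp: fp_words_Cons_iff)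
  obtain s n p where i: "i = ((s, n), p)" by (metis surj_pair)
  have s: "s = isl x" "length p \<le> 1" using letter_support[OF x, of s n p] A i by auto
  from A i have "\<pi> [x] (b w) ((s, n), p) \<noteq> 0" by simp
  from translation_support[OF x this] obtain r
    where r: "p = [x] \<otimes>\<^bsub>P\<^esub> r" "b w ((s, n), r) \<noteq> 0" by blast
  have "w \<noteq> []" "isl (hd w) \<noteq> isl x"
    using b_support[OF w r(2)] assms by (auto simp: fp_words_Cons_iff)
  then have "r \<noteq> []" "isl (hd r) \<noteq> isl x"
    using b_support[OF w r(2)] s(1) by (auto split: if_splits)
  then have "p = x # r" using r(1) fp_cons_eq_Cons[of r x G H] by (simp flip: fp_cons_eq_mult)
  then show False using s(2) \<open>r \<noteq> []\<close> by simp
qed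

lemma b_norm:
  assumes "w \<in> W"
  shows "(l2_norm X (b w))\<^sup>2 = (\<Sum>x\<leftarrow>w. (l2_norm X (\<iota> x))\<^sup>2)"
  using assms
proof (induction w)
  case (Cons x w)
  then have x: "x \<in> L" and w: "w \<in> W" by (auto simp: fp_words_Cons_iff)
  have "(l2_norm X (b (x # w)))\<^sup>2 = (l2_norm X (\<iota> x))\<^sup>2 + (l2_norm X (\<pi> [x] (b w)))\<^sup>2"
    unfolding word_cochain.simps
    by (intro l2_norm_pythagoras letter_l2 T.rho_l2_space b_l2 letter_support_disjoint)
       (use x w Cons.prems in simp_all)
  moreover have "l2_norm X (\<pi> [x] (b w)) = l2_norm X (b w)"
    using x w by (intro T.l2_norm_rho b_l2) simp_all
  ultimately show "(l2_norm X (b (x # w)))\<^sup>2 = (\<Sum>x\<leftarrow>x # w. (l2_norm X (\<iota> x))\<^sup>2)"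
    using Cons.IH[OF w] by simp
qed simp

lemma proper_quasi_b:
  assumes one: "\<And>x. x \<in> L \<Longrightarrow> 1 \<le> l2_norm X (\<iota> x)"
    and fin: "\<And>R. R > 0 \<Longrightarrow> finite {x \<in> L. l2_norm X (\<iota> x) \<le> R}"
  shows "T.proper_quasi b"
proof
  have "l2_norm X (\<pi> v (b w) - b (v \<otimes>\<^bsub>P\<^esub> w) + b v) \<le> C" if "v \<in> W" "w \<in> W" for v w
    using word_defect[OF that] C_nonneg by auto
  then show "quasi_1_cocycle P (l2_space X) (l2_norm X) \<pi> b"
    using b_l2 unfolding quasi_1_cocycle_def by auto
  have "finite {w \<in> W. l2_norm X (b w) \<le> R}" if R: "R > 0" for R
  proof (rule finite_subset)
    let ?F = "{x \<in> L. l2_norm X (\<iota> x) \<le> R}"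
    show "finite {w. set w \<subseteq> ?F \<and> length w \<le> nat \<lfloor>R\<^sup>2\<rfloor>}"
      by (rule finite_lists_length_le[OF fin[OF R]])
    show "{w \<in> W. l2_norm X (b w) \<le> R} \<subseteq> {w. set w \<subseteq> ?F \<and> length w \<le> nat \<lfloor>R\<^sup>2\<rfloor>}"
    proof safe
      fix w assume w: "w \<in> W" and le: "l2_norm X (b w) \<le> R"
      have "(l2_norm X (b w))\<^sup>2 \<le> R\<^sup>2" using le by (intro power_mono) auto
      then have sum: "(\<Sum>x\<leftarrow>w. (l2_norm X (\<iota> x))\<^sup>2) \<le> R\<^sup>2" using b_norm[OF w] by simp
      have wL: "set w \<subseteq> L" using w by (auto simp: fp_words_def)
      have "real (length w) = (\<Sum>x\<leftarrow>w. 1)" by (simp add: sum_list_triv)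
      also have "\<dots> \<le> (\<Sum>x\<leftarrow>w. (l2_norm X (\<iota> x))\<^sup>2)"
        using one wL by (intro sum_list_mono) auto
      finally show "length w \<le> nat \<lfloor>R\<^sup>2\<rfloor>" using sum by (simp add: le_nat_floor)
      fix x assume x: "x \<in> set w"
      then show "x \<in> L" using wL by blast
      have "(l2_norm X (\<iota> x))\<^sup>2 \<le> (\<Sum>x\<leftarrow>w. (l2_norm X (\<iota> x))\<^sup>2)"
        using x by (intro member_le_sum_list) auto
      then show "l2_norm X (\<iota> x) \<le> R" using sum R by (meson order_trans less_imp_le power2_le_imp_le)
    qed
  qed
  then show "proper_cochain P (l2_norm X) b" by (simp add: proper_cochain_def)
qed

end

section \<open>The free product\<close>

lemma countable_fp_words:
  assumes "countable (carrier G)" "countable (carrier H)"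
  shows "countable (fp_words G H)"
proof (rule countable_subset)
  have "fp_letters G H \<subseteq> Inl ` carrier G \<union> Inr ` carrier H"
    by (auto simp: fp_letters_def)
  then have "countable (fp_letters G H)"
    using assms by (meson countable_Un countable_image countable_subset)
  then show "countable (lists (fp_letters G H))" by (rule countable_lists)
qed (auto simp: fp_words_def)

definition factor_word :: "('k, 'm) monoid_scheme \<Rightarrow> ('k \<Rightarrow> 'l) \<Rightarrow> 'k \<Rightarrow> 'l list" where
  "factor_word K f k = (if k = \<one>\<^bsub>K\<^esub> then [] else [f k])"

text \<open>
  The letter vectors of one factor \<open>K\<close>, with \<open>f\<close> the injection of its letters: a quasi-cocycle of
  \<open>K\<close>, transported along the inclusion of \<open>K\<close> as a subgroup of the free product into the copies
  labelled by \<open>s\<close>.  Treating \<open>K\<close> abstractly covers both factors.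
\<close>

lemma factor_cochain:
  fixes G :: "('a, 'm) monoid_scheme" and H :: "('b, 'n) monoid_scheme"
    and K :: "('k, 'o) monoid_scheme" and f :: "'k \<Rightarrow> 'a + 'b" and s :: bool
    and c :: "'k \<Rightarrow> nat \<times> 'k \<Rightarrow> complex"
  defines "X \<equiv> (UNIV :: (bool \<times> nat) set) \<times> fp_words G H"
    and "\<pi> \<equiv> perm_rep (free_product G H) (UNIV \<times> fp_words G H) (translation (free_product G H))"
    and "Y \<equiv> UNIV \<times> carrier K"
  assumes groups: "group G" "group H" "group K"
    and f: "inj f" "\<And>k. k \<in> carrier K \<Longrightarrow> k \<noteq> \<one>\<^bsub>K\<^esub> \<Longrightarrow> f k \<in> fp_letters G H"
      "\<And>k l. fp_cons G H (f k) [f l] = factor_word K f (k \<otimes>\<^bsub>K\<^esub> l)" "\<And>k. isl (f k) = s"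
    and c: "free_gset.proper_quasi K Y (translation K) c"
      "\<And>k. k \<in> carrier K \<Longrightarrow> c k + perm_rep K Y (translation K) k (c (inv\<^bsub>K\<^esub> k)) = 0"
    and \<kappa>: "\<kappa> = (\<lambda>k. push (\<lambda>(n, l). ((s, n), factor_word K f l)) Y (c k))"
  shows "\<And>k. k \<in> carrier K \<Longrightarrow> \<kappa> k \<in> l2_space X"
    and "\<And>k. k \<in> carrier K \<Longrightarrow> l2_norm X (\<kappa> k) = l2_norm Y (c k)"
    and "\<And>k t n p. \<kappa> k ((t, n), p) \<noteq> 0 \<Longrightarrow> t = s \<and> (p = [] \<or> (\<exists>y. p = [y] \<and> isl y = s))"
    and "\<And>k l. k \<in> carrier K - {\<one>\<^bsub>K\<^esub>} \<Longrightarrow> l \<in> carrier K - {\<one>\<^bsub>K\<^esub>} \<Longrightarrow> k \<otimes>\<^bsub>K\<^esub> l = \<one>\<^bsub>K\<^esub> \<Longrightarrow>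
      \<kappa> k + \<pi> [f k] (\<kappa> l) = 0"
    and "\<exists>C. \<forall>k\<in>carrier K - {\<one>\<^bsub>K\<^esub>}. \<forall>l\<in>carrier K - {\<one>\<^bsub>K\<^esub>}.
      l2_norm X (\<pi> [f k] (\<kappa> l) - \<kappa> (k \<otimes>\<^bsub>K\<^esub> l) + \<kappa> k) \<le> C"
proof -
  let ?P = "free_product G H"
  define e where "e = factor_word K f"
  define j where "j = (\<lambda>(n :: nat, k). ((s, n), e k))"
  interpret K: group K by fact
  interpret P: group ?P by (rule group_free_product) fact+
  interpret Y: free_gset K Y "translation K"
    unfolding Y_def by (rule free_gset_translation) fact
  interpret X: free_gset ?P X "translation ?P"
    using free_gset_translation[OF P.group_axioms] by (simp add: X_def free_product_def)
  have P: "carrier ?P = fp_words G H" "v \<otimes>\<^bsub>?P\<^esub> w = foldr (fp_cons G H) v w" "\<one>\<^bsub>?P\<^esub> = []" for v w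
    by (simp_all add: free_product_def)
  have e_closed: "e k \<in> carrier ?P" if "k \<in> carrier K" for k
    using f(2) that by (simp add: e_def factor_word_def P(1) fp_words_Cons_iff)
  have e_mult: "e (k \<otimes>\<^bsub>K\<^esub> l) = e k \<otimes>\<^bsub>?P\<^esub> e l" if "k \<in> carrier K" "l \<in> carrier K" for k l
    using that f(3)[of k l] fp_cons_eq_Cons[of "[]" "f k" G H]
    by (auto simp: e_def factor_word_def P(2))
  interpret e: group_hom K ?P e
    by unfold_locales (auto simp: hom_def e_closed e_mult)
  have e_inj: "e k = e l \<longleftrightarrow> k = l" for k l
    using f(1) by (auto simp: e_def factor_word_def dest: injD)
  have j: "inj_on j Y" "j ` Y \<subseteq> X"
    using e_closed by (auto simp: j_def Y_def X_def P(1) inj_on_def e_inj)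
  have \<kappa>_def: "\<kappa> k = push j Y (c k)" for k
    unfolding \<kappa> j_def e_def ..
  have cY: "c k \<in> l2_space Y" if "k \<in> carrier K" for k
    using c(1) that by (auto simp: quasi_1_cocycle_def)
  obtain C where C: "\<And>g h. g \<in> carrier K \<Longrightarrow> h \<in> carrier K \<Longrightarrow>
      l2_norm Y (Y.\<rho> g (c h) - c (g \<otimes>\<^bsub>K\<^esub> h) + c g) \<le> C"
    using c(1) unfolding quasi_1_cocycle_def by blast
  have e_letter: "e k = [f k]" if "k \<noteq> \<one>\<^bsub>K\<^esub>" for k
    using that by (simp add: e_def factor_word_def)
  have equivariant: "\<pi> [f k] (\<kappa> l) = push j Y (Y.\<rho> k (c l))"
    if "k \<in> carrier K - {\<one>\<^bsub>K\<^esub>}" for k l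
  proof -
    have "push j Y (Y.\<rho> k (c l)) = X.\<rho> (e k) (push j Y (c l))"
      by (rule push_perm_rep[OF X.free_gset_axioms Y.free_gset_axioms])
         (use that j in \<open>auto simp: e_closed e_mult j_def Y_def\<close>)
    then show ?thesis using that by (simp add: \<kappa>_def \<pi>_def X_def e_letter)
  qed
  show "\<kappa> k \<in> l2_space X" "l2_norm X (\<kappa> k) = l2_norm Y (c k)" if "k \<in> carrier K" for k
    unfolding \<kappa>_def using push_l2_space[OF j cY[OF that]] l2_norm_push[OF j cY[OF that]] by auto
  show "t = s \<and> (p = [] \<or> (\<exists>y. p = [y] \<and> isl y = s))" if "\<kappa> k ((t, n), p) \<noteq> 0" for k t n p
  proof -
    have "((t, n), p) \<in> j ` Y" using that by (auto simp: \<kappa>_def push_def split: if_splits)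
    then obtain l where "t = s" "p = e l" by (auto simp: j_def)
    then show ?thesis using f(4) by (cases "l = \<one>\<^bsub>K\<^esub>") (simp_all add: e_def factor_word_def)
  qed
  show "\<kappa> k + \<pi> [f k] (\<kappa> l) = 0"
    if kl: "k \<in> carrier K - {\<one>\<^bsub>K\<^esub>}" "l \<in> carrier K - {\<one>\<^bsub>K\<^esub>}" and "k \<otimes>\<^bsub>K\<^esub> l = \<one>\<^bsub>K\<^esub>" for k l
  proof -
    have "l = inv\<^bsub>K\<^esub> k" using that by (metis Diff_iff K.inv_equality K.inv_inv K.inv_closed)
    then have "c k + Y.\<rho> k (c l) = 0" using c(2) kl by auto
    then show ?thesis
      unfolding equivariant[OF kl(1)] unfolding \<kappa>_def by (simp add: push_zero flip: push_add)
  qed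
  have "l2_norm X (\<pi> [f k] (\<kappa> l) - \<kappa> (k \<otimes>\<^bsub>K\<^esub> l) + \<kappa> k) \<le> C"
    if kl: "k \<in> carrier K - {\<one>\<^bsub>K\<^esub>}" "l \<in> carrier K - {\<one>\<^bsub>K\<^esub>}" for k l
  proof -
    have "\<pi> [f k] (\<kappa> l) - \<kappa> (k \<otimes>\<^bsub>K\<^esub> l) + \<kappa> k
      = push j Y (Y.\<rho> k (c l) - c (k \<otimes>\<^bsub>K\<^esub> l) + c k)"
      unfolding equivariant[OF kl(1)] unfolding \<kappa>_def by (simp add: push_add push_diff)
    moreover have "Y.\<rho> k (c l) - c (k \<otimes>\<^bsub>K\<^esub> l) + c k \<in> l2_space Y"
      using kl cY by (intro l2_space_closed Y.rho_l2_space) auto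
    ultimately show ?thesis
      using C[of k l] kl by (simp add: l2_norm_push[OF j])
  qed
  then show "\<exists>C. \<forall>k\<in>carrier K - {\<one>\<^bsub>K\<^esub>}. \<forall>l\<in>carrier K - {\<one>\<^bsub>K\<^esub>}.
      l2_norm X (\<pi> [f k] (\<kappa> l) - \<kappa> (k \<otimes>\<^bsub>K\<^esub> l) + \<kappa> k) \<le> C" by blast
qed

theorem admits_free_product:
  fixes G :: "('a, 'm) monoid_scheme" and H :: "('b, 'n) monoid_scheme"
  assumes "admits_proper_quasi_1_cocycle G" "admits_proper_quasi_1_cocycle H"
  shows "admits_proper_quasi_1_cocycle (free_product G H)"
proof -
  have G: "group G" and H: "group H" and countable: "countable (carrier G)" "countable (carrier H)"
    using assms by (auto simp: admits_proper_quasi_1_cocycle_def)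
  let ?X = "(UNIV :: (bool \<times> nat) set) \<times> fp_words G H"
  let ?\<pi> = "perm_rep (free_product G H) ?X (translation (free_product G H))"
  let ?YG = "(UNIV :: nat set) \<times> carrier G" and ?YH = "(UNIV :: nat set) \<times> carrier H"
  interpret YG: free_gset G ?YG "translation G" by (rule free_gset_translation[OF G])
  interpret YH: free_gset H ?YH "translation H" by (rule free_gset_translation[OF H])
  have ne: "?YG \<noteq> {}" "?YH \<noteq> {}" using YG.one_closed YH.one_closed by blast+
  obtain c0 where "YG.proper_quasi c0" using admits_proper_quasiD[OF assms(1)] by blast
  then obtain c where c: "YG.proper_quasi c"
      "\<And>g. g \<in> carrier G \<Longrightarrow> c g + YG.\<rho> g (c (inv\<^bsub>G\<^esub> g)) = 0"
      "\<And>g. g \<in> carrier G \<Longrightarrow> g \<noteq> \<one>\<^bsub>G\<^esub> \<Longrightarrow> 1 \<le> l2_norm ?YG (c g)"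
    using YG.proper_quasi_normalised[OF ne(1)] by metis
  obtain d0 where "YH.proper_quasi d0" using admits_proper_quasiD[OF assms(2)] by blast
  then obtain d where d: "YH.proper_quasi d"
      "\<And>h. h \<in> carrier H \<Longrightarrow> d h + YH.\<rho> h (d (inv\<^bsub>H\<^esub> h)) = 0"
      "\<And>h. h \<in> carrier H \<Longrightarrow> h \<noteq> \<one>\<^bsub>H\<^esub> \<Longrightarrow> 1 \<le> l2_norm ?YH (d h)"
    using YH.proper_quasi_normalised[OF ne(2)] by metis
  define \<kappa> where
    "\<kappa> = (\<lambda>k. push (\<lambda>(n, l). ((True, n), factor_word G (Inl :: _ \<Rightarrow> 'a + 'b) l)) ?YG (c k))"
  have fG: "\<And>k. k \<in> carrier G \<Longrightarrow> k \<noteq> \<one>\<^bsub>G\<^esub> \<Longrightarrow> Inl k \<in> fp_letters G H"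
    "\<And>k l. fp_cons G H (Inl k) [Inl l] = factor_word G Inl (k \<otimes>\<^bsub>G\<^esub> l)"
    "\<And>k. isl (Inl k :: 'a + 'b) = True"
    by (auto simp: fp_letters_def factor_word_def)
  note \<kappa> = factor_cochain[where K = G and f = Inl and s = True and c = c and \<kappa> = \<kappa>,
      OF G H G inj_Inl fG c(1,2) \<kappa>_def]
  obtain CG where CG: "\<And>k l. k \<in> carrier G - {\<one>\<^bsub>G\<^esub>} \<Longrightarrow> l \<in> carrier G - {\<one>\<^bsub>G\<^esub>} \<Longrightarrow>
      l2_norm ?X (?\<pi> [Inl k] (\<kappa> l) - \<kappa> (k \<otimes>\<^bsub>G\<^esub> l) + \<kappa> k) \<le> CG"
    using \<kappa>(5) by blast
  define \<mu> where
    "\<mu> = (\<lambda>k. push (\<lambda>(n, l). ((False, n), factor_word H (Inr :: _ \<Rightarrow> 'a + 'b) l)) ?YH (d k))"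
  have fH: "\<And>k. k \<in> carrier H \<Longrightarrow> k \<noteq> \<one>\<^bsub>H\<^esub> \<Longrightarrow> Inr k \<in> fp_letters G H"
    "\<And>k l. fp_cons G H (Inr k) [Inr l] = factor_word H Inr (k \<otimes>\<^bsub>H\<^esub> l)"
    "\<And>k. isl (Inr k :: 'a + 'b) = False"
    by (auto simp: fp_letters_def factor_word_def)
  note \<mu> = factor_cochain[where K = H and f = Inr and s = False and c = d and \<kappa> = \<mu>,
      OF G H H inj_Inr fH d(1,2) \<mu>_def]
  obtain CH where CH: "\<And>k l. k \<in> carrier H - {\<one>\<^bsub>H\<^esub>} \<Longrightarrow> l \<in> carrier H - {\<one>\<^bsub>H\<^esub>} \<Longrightarrow>
      l2_norm ?X (?\<pi> [Inr k] (\<mu> l) - \<mu> (k \<otimes>\<^bsub>H\<^esub> l) + \<mu> k) \<le> CH"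
    using \<mu>(5) by blast
  define \<iota> where "\<iota> = case_sum \<kappa> \<mu>"
  define C where "C = max 0 (max CG CH)"
  have C: "0 \<le> C" "CG \<le> C" "CH \<le> C" by (auto simp: C_def)
  interpret letter_cochain G H \<iota> C
  proof
    show "0 \<le> C" by fact
    fix x assume x: "x \<in> fp_letters G H"
    show "\<iota> x \<in> l2_space ?X" using x \<kappa>(1) \<mu>(1) by (auto simp: fp_letters_def \<iota>_def)
    show "s = isl x \<and> (p = [] \<or> (\<exists>y. p = [y] \<and> isl y = isl x))"
      if "\<iota> x ((s, n), p) \<noteq> 0" for s n p
    proof (cases x)
      case (Inl a)
      then show ?thesis using that \<kappa>(3)[of a s n p] by (simp add: \<iota>_def)
    next
      case (Inr a)
      then show ?thesis using that \<mu>(3)[of a s n p] by (simp add: \<iota>_def)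
    qed
    fix y assume y: "y \<in> fp_letters G H" and same: "isl x = isl y"
    show "\<iota> x + ?\<pi> [x] (\<iota> y) = 0" if "fp_cons G H x [y] = []"
      using x y same that \<kappa>(4) \<mu>(4)
      by (cases x; cases y) (auto simp: fp_letters_def \<iota>_def split: if_splits)
    show "l2_norm ?X (?\<pi> [x] (\<iota> y) - \<iota> z + \<iota> x) \<le> C" if z: "fp_cons G H x [y] = [z]" for z
    proof (cases x)
      case (Inl a)
      then obtain a' where y': "y = Inl a'" using same by (cases y) auto
      have "z = Inl (a \<otimes>\<^bsub>G\<^esub> a')" using z Inl y' by (simp split: if_splits)
      moreover have "a \<in> carrier G - {\<one>\<^bsub>G\<^esub>}" "a' \<in> carrier G - {\<one>\<^bsub>G\<^esub>}"
        using x y Inl y' by (auto simp: fp_letters_def)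
      ultimately show ?thesis using CG[of a a'] C Inl y' by (simp add: \<iota>_def)
    next
      case (Inr a)
      then obtain a' where y': "y = Inr a'" using same by (cases y) auto
      have "z = Inr (a \<otimes>\<^bsub>H\<^esub> a')" using z Inr y' by (simp split: if_splits)
      moreover have "a \<in> carrier H - {\<one>\<^bsub>H\<^esub>}" "a' \<in> carrier H - {\<one>\<^bsub>H\<^esub>}"
        using x y Inr y' by (auto simp: fp_letters_def)
      ultimately show ?thesis using CH[of a a'] C Inr y' by (simp add: \<iota>_def)
    qed
  qed
  have "1 \<le> l2_norm X (\<iota> x)" if "x \<in> L" for x
    using that \<kappa>(2) \<mu>(2) by (auto simp: fp_letters_def \<iota>_def intro!: c(3) d(3))
  moreover have "finite {x \<in> L. l2_norm X (\<iota> x) \<le> R}" if "R > 0" for R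
  proof (rule finite_subset)
    let ?F = "Inl ` {g \<in> carrier G. l2_norm ?YG (c g) \<le> R} \<union> Inr ` {h \<in> carrier H. l2_norm ?YH (d h) \<le> R}"
    show "finite ?F" using c(1) d(1) that by (simp add: proper_cochain_def)
    show "{x \<in> L. l2_norm X (\<iota> x) \<le> R} \<subseteq> ?F"
      using \<kappa>(2) \<mu>(2) by (auto simp: fp_letters_def \<iota>_def)
  qed
  ultimately have "T.proper_quasi b" by (rule proper_quasi_b)
  moreover have "countable W" using countable_fp_words[OF countable] .
  ultimately show ?thesis by (intro T.admits_if_proper_quasi) auto
qed

theorem theorem5p3:
  fixes G :: "'a monoid" and H :: "'b monoid" and K :: "'a set"
  shows "(admits_proper_quasi_1_cocycle G \<longrightarrow> subgroup K G \<longrightarrow>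
            admits_proper_quasi_1_cocycle (G\<lparr>carrier := K\<rparr>)) \<and>
         (admits_proper_quasi_1_cocycle G \<longrightarrow> admits_proper_quasi_1_cocycle H \<longrightarrow>
            admits_proper_quasi_1_cocycle (free_product G H))"
  by (simp add: admits_subgroup admits_free_product)

end
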